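(* The radical classes of hemirings of the Jacobson radical $J$, of the Brown-McCoy radical $\mathcal{R}_{BM}$, and of the radical $J_s$, that is, the classes $\{R\mid J(R)=R\}$, $\{R\mid\mathcal{R}_{BM}(R)=R\}$ and $\{R\mid J_s(R)=R\}$ of hemirings, are matric-extensible classes.
   Context: A class $\delta$ of hemirings is matric-extensible if for every natural number $n\ge1$ and every hemiring $R$: $R\in\delta$ if and only if $M_n(R)\in\delta$. A hemiring $(R,+,\cdot,0)$ consists of a commutative monoid $(R,+,0)$ and a semigroup $(R,\cdot)$ such that multiplication distributes over addition on both sides and $0r=0=r0$ for all $r$. A semiring is a hemiring with a multiplicative identity $1$. Ideals are two-sided and are regarded as hemirings. A left $R$-semimodule is a commutative monoid $(M,+,0_M)$ with a scalar multiplication $R\times M\to M$ satisfying $(rr')m=r(r'm)$, $r(m+m')=rm+rm'$, $(r+r')m=rm+r'm$, $r0_M=0_M=0m$. Write $(0:M)_R=\{r\in R\mid rM=0\}$. Brown-McCoy radical: a hemiring $R$ is ideal-simple if its only ideals are $0$ and $R$. Let $\mathcal{U}\mathbb{S}$ be the class of all hemirings having no nonzero homomorphic image that is an ideal-simple semiring. $\mathcal{R}_{BM}(R)$ is the union of all ideals of $R$ belonging to $\mathcal{U}\mathbb{S}$ (it is the greatest such ideal). $J_s$: a left $R$-semimodule $M$ is simple if $RM\neq0$, its only subsemimodules are $0$ and $M$, and its only semimodule congruences are the diagonal and $M^2$. $J_s(R):=\bigcap(0:M)_R$ over all simple left $R$-semimodules $M$ (equal to $R$ if there are none). Jacobson(-Bourne)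 radical: a right ideal $I$ of $R$ is right semiregular if for all $i_1,i_2\in I$ there are $j_1,j_2\in I$ with $i_1+j_1+i_1j_1+i_2j_2=i_2+j_2+i_1j_2+i_2j_1$; $J(R)$ is the sum of all right semiregular right ideals of $R$. Equivalently (known), $J(R)=\bigcap(0:M)_R$ over all irreducible left $R$-semimodules $M$ (with $J(R)=R$ if there are none), where a nonzero additively cancellative left semimodule $M$ is irreducible if for all $m_1\neq m_2$ and $m$ in $M$ there are $r_1,r_2\in R$ with $m+r_1m_1+r_2m_2=r_1m_2+r_2m_1$. *)

theory Defs
  imports "HOL-Algebra.Module" "HOL-Library.FuncSet"
begin

section \<open>Hemirings\<close>

text \<open>
  Hemirings are represented by the record type of HOL-Algebra rings.  The field \<open>one\<close> of that
  record carries no meaning here: it is read below only to fill the equally meaningless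
  \<open>one\<close> field of a constructed structure.
\<close>

locale hemiring = abelian_monoid R for R (structure) +
  assumes m_closed: "\<lbrakk> x \<in> carrier R; y \<in> carrier R \<rbrakk> \<Longrightarrow> x \<otimes> y \<in> carrier R"
    and m_assoc: "\<lbrakk> x \<in> carrier R; y \<in> carrier R; z \<in> carrier R \<rbrakk> \<Longrightarrow> (x \<otimes> y) \<otimes> z = x \<otimes> (y \<otimes> z)"
    and l_distr: "\<lbrakk> x \<in> carrier R; y \<in> carrier R; z \<in> carrier R \<rbrakk> \<Longrightarrow> (x \<oplus> y) \<otimes> z = x \<otimes> z \<oplus> y \<otimes> z"
    and r_distr: "\<lbrakk> x \<in> carrier R; y \<in> carrier R; z \<in> carrier R \<rbrakk> \<Longrightarrow> z \<otimes> (x \<oplus> y) = z \<otimes> x \<oplus> z \<otimes> y"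
    and l_null: "x \<in> carrier R \<Longrightarrow> \<zero> \<otimes> x = \<zero>"
    and r_null: "x \<in> carrier R \<Longrightarrow> x \<otimes> \<zero> = \<zero>"

definition has_unity :: "'a ring \<Rightarrow> bool" where
  "has_unity R \<longleftrightarrow>
     (\<exists>e\<in>carrier R. \<forall>x\<in>carrier R. e \<otimes>\<^bsub>R\<^esub> x = x \<and> x \<otimes>\<^bsub>R\<^esub> e = x)"

definition right_ideal :: "'a ring \<Rightarrow> 'a set \<Rightarrow> bool" where
  "right_ideal R I \<longleftrightarrow> I \<subseteq> carrier R \<and> \<zero>\<^bsub>R\<^esub> \<in> I \<and>
     (\<forall>x\<in>I. \<forall>y\<in>I. x \<oplus>\<^bsub>R\<^esub> y \<in> I) \<and> (\<forall>x\<in>I. \<forall>r\<in>carrier R. x \<otimes>\<^bsub>R\<^esub> r \<in> I)"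

definition hemiring_ideal :: "'a ring \<Rightarrow> 'a set \<Rightarrow> bool" where
  "hemiring_ideal R I \<longleftrightarrow> I \<subseteq> carrier R \<and> \<zero>\<^bsub>R\<^esub> \<in> I \<and>
     (\<forall>x\<in>I. \<forall>y\<in>I. x \<oplus>\<^bsub>R\<^esub> y \<in> I) \<and>
     (\<forall>x\<in>I. \<forall>r\<in>carrier R. r \<otimes>\<^bsub>R\<^esub> x \<in> I \<and> x \<otimes>\<^bsub>R\<^esub> r \<in> I)"

definition ideal_as_hemiring :: "'a ring \<Rightarrow> 'a set \<Rightarrow> 'a ring" where
  "ideal_as_hemiring R I = R\<lparr>carrier := I\<rparr>"

text \<open>The library's \<open>ring_hom\<close> is not usable, since it preserves \<open>one\<close>.\<close>

definition hemiring_hom :: "'a ring \<Rightarrow> 'b ring \<Rightarrow> ('a \<Rightarrow> 'b) set" where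
  "hemiring_hom R S =
     {h \<in> hom R S \<inter> hom (add_monoid R) (add_monoid S). h \<zero>\<^bsub>R\<^esub> = \<zero>\<^bsub>S\<^esub>}"

definition hom_image :: "'a ring \<Rightarrow> 'b ring \<Rightarrow> bool" where
  "hom_image R S \<longleftrightarrow>
     hemiring S \<and> (\<exists>h\<in>hemiring_hom R S. h ` carrier R = carrier S)"

section \<open>Matrix hemirings and matric-extensible classes\<close>

text \<open>
  An \<open>n \<times> n\<close> matrix is an extensional function on the index set \<open>{..<n} \<times> {..<n}\<close>, so that
  equality of matrices is equality of entries.
\<close>

definition matrix_hemiring :: "nat \<Rightarrow> 'a ring \<Rightarrow> (nat \<times> nat \<Rightarrow> 'a) ring" where
  "matrix_hemiring n R =
     \<lparr> carrier = ({..<n} \<times> {..<n}) \<rightarrow>\<^sub>E carrier R,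
       mult = (\<lambda>A B. \<lambda>(i, j)\<in>{..<n} \<times> {..<n}. \<Oplus>\<^bsub>R\<^esub>k\<in>{..<n}. A (i, k) \<otimes>\<^bsub>R\<^esub> B (k, j)),
       one = (\<lambda>(i, j)\<in>{..<n} \<times> {..<n}. if i = j then \<one>\<^bsub>R\<^esub> else \<zero>\<^bsub>R\<^esub>),
       zero = (\<lambda>(i, j)\<in>{..<n} \<times> {..<n}. \<zero>\<^bsub>R\<^esub>),
       add = (\<lambda>A B. \<lambda>(i, j)\<in>{..<n} \<times> {..<n}. A (i, j) \<oplus>\<^bsub>R\<^esub> B (i, j)) \<rparr>"

text \<open>
  A class of hemirings contains hemirings over every carrier type, but a bound variable of HOL
  ranges over hemirings on a single type.  Hence a class enters the following definition through
  two of its instances: its members on the type \<open>'a\<close> and its members on the type of matrices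
  over \<open>'a\<close>.  It is meant to be applied to two instances of one polymorphic constant.
\<close>

definition matric_extensible :: "'a ring set \<Rightarrow> (nat \<times> nat \<Rightarrow> 'a) ring set \<Rightarrow> bool" where
  "matric_extensible \<delta> \<delta>' \<longleftrightarrow>
     (\<forall>n\<ge>1. \<forall>R. hemiring R \<longrightarrow> (R \<in> \<delta> \<longleftrightarrow> matrix_hemiring n R \<in> \<delta>'))"

section \<open>The Brown-McCoy radical\<close>

definition ideal_simple :: "'a ring \<Rightarrow> bool" where
  "ideal_simple R \<longleftrightarrow> (\<forall>I. hemiring_ideal R I \<longrightarrow> I = {\<zero>\<^bsub>R\<^esub>} \<or> I = carrier R)"

text \<open>
  Homomorphic images are taken on the type \<open>'a set\<close>, where the quotients of \<open>R\<close> by its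
  congruences live.  Lemma \<open>upper_class_image\<close> below shows that this covers homomorphic
  images on every type.
\<close>

definition upper_class :: "'a ring set" where
  "upper_class =
     {R. hemiring R \<and>
         \<not> (\<exists>S :: 'a set ring. hom_image R S \<and> carrier S \<noteq> {\<zero>\<^bsub>S\<^esub>} \<and> ideal_simple S \<and> has_unity S)}"

definition brown_mccoy_radical :: "'a ring \<Rightarrow> 'a set" where
  "brown_mccoy_radical R =
     \<Union>{I. hemiring_ideal R I \<and> ideal_as_hemiring R I \<in> upper_class}"

section \<open>Semimodules and the radical \<open>J\<^sub>s\<close>\<close>

text \<open>The fields \<open>mult\<close> and \<open>one\<close> of the module record \<open>M\<close> are not used.\<close>

locale left_semimodule = R?: hemiring R + M?: abelian_monoid M
  for R :: "'a ring" (structure) and M :: "('a, 'b) module" (structure) +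
  assumes smult_closed: "\<lbrakk> r \<in> carrier R; m \<in> carrier M \<rbrakk> \<Longrightarrow> r \<odot>\<^bsub>M\<^esub> m \<in> carrier M"
    and smult_assoc: "\<lbrakk> r \<in> carrier R; r' \<in> carrier R; m \<in> carrier M \<rbrakk> \<Longrightarrow>
      (r \<otimes> r') \<odot>\<^bsub>M\<^esub> m = r \<odot>\<^bsub>M\<^esub> (r' \<odot>\<^bsub>M\<^esub> m)"
    and smult_r_distr: "\<lbrakk> r \<in> carrier R; m \<in> carrier M; m' \<in> carrier M \<rbrakk> \<Longrightarrow>
      r \<odot>\<^bsub>M\<^esub> (m \<oplus>\<^bsub>M\<^esub> m') = r \<odot>\<^bsub>M\<^esub> m \<oplus>\<^bsub>M\<^esub> r \<odot>\<^bsub>M\<^esub> m'"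
    and smult_l_distr: "\<lbrakk> r \<in> carrier R; r' \<in> carrier R; m \<in> carrier M \<rbrakk> \<Longrightarrow>
      (r \<oplus> r') \<odot>\<^bsub>M\<^esub> m = r \<odot>\<^bsub>M\<^esub> m \<oplus>\<^bsub>M\<^esub> r' \<odot>\<^bsub>M\<^esub> m"
    and smult_r_null: "r \<in> carrier R \<Longrightarrow> r \<odot>\<^bsub>M\<^esub> \<zero>\<^bsub>M\<^esub> = \<zero>\<^bsub>M\<^esub>"
    and smult_l_null: "m \<in> carrier M \<Longrightarrow> \<zero> \<odot>\<^bsub>M\<^esub> m = \<zero>\<^bsub>M\<^esub>"

definition annihilator :: "'a ring \<Rightarrow> ('a, 'b) module \<Rightarrow> 'a set" where
  "annihilator R M = {r \<in> carrier R. \<forall>m\<in>carrier M. r \<odot>\<^bsub>M\<^esub> m = \<zero>\<^bsub>M\<^esub>}"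

definition subsemimodule :: "'a ring \<Rightarrow> ('a, 'b) module \<Rightarrow> 'b set \<Rightarrow> bool" where
  "subsemimodule R M N \<longleftrightarrow> N \<subseteq> carrier M \<and> \<zero>\<^bsub>M\<^esub> \<in> N \<and>
     (\<forall>x\<in>N. \<forall>y\<in>N. x \<oplus>\<^bsub>M\<^esub> y \<in> N) \<and> (\<forall>r\<in>carrier R. \<forall>x\<in>N. r \<odot>\<^bsub>M\<^esub> x \<in> N)"

definition semimodule_congruence :: "'a ring \<Rightarrow> ('a, 'b) module \<Rightarrow> ('b \<times> 'b) set \<Rightarrow> bool" where
  "semimodule_congruence R M \<rho> \<longleftrightarrow> equiv (carrier M) \<rho> \<and>
     (\<forall>(x, x')\<in>\<rho>. \<forall>(y, y')\<in>\<rho>. (x \<oplus>\<^bsub>M\<^esub> y, x' \<oplus>\<^bsub>M\<^esub> y') \<in> \<rho>) \<and>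
     (\<forall>r\<in>carrier R. \<forall>(x, x')\<in>\<rho>. (r \<odot>\<^bsub>M\<^esub> x, r \<odot>\<^bsub>M\<^esub> x') \<in> \<rho>)"

definition simple_semimodule :: "'a ring \<Rightarrow> ('a, 'b) module \<Rightarrow> bool" where
  "simple_semimodule R M \<longleftrightarrow> left_semimodule R M \<and>
     (\<exists>r\<in>carrier R. \<exists>m\<in>carrier M. r \<odot>\<^bsub>M\<^esub> m \<noteq> \<zero>\<^bsub>M\<^esub>) \<and>
     (\<forall>N. subsemimodule R M N \<longrightarrow> N = {\<zero>\<^bsub>M\<^esub>} \<or> N = carrier M) \<and>
     (\<forall>\<rho>. semimodule_congruence R M \<rho> \<longrightarrow> \<rho> = Id_on (carrier M) \<or> \<rho> = carrier M \<times> carrier M)"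

text \<open>
  The semimodules \<open>M\<close> range over the type \<open>'a set\<close>.  A simple semimodule is of the form \<open>R m\<close>,
  hence isomorphic to a quotient of the left semimodule \<open>R\<close>, and so nothing is lost:
  see lemma \<open>J_s_subset_annihilator\<close> below.
\<close>

definition J_s :: "'a ring \<Rightarrow> 'a set" where
  "J_s R = {r \<in> carrier R. \<forall>M :: ('a, 'a set) module. simple_semimodule R M \<longrightarrow> r \<in> annihilator R M}"

section \<open>The Jacobson radical\<close>

definition right_semiregular :: "'a ring \<Rightarrow> 'a set \<Rightarrow> bool" where
  "right_semiregular R I \<longleftrightarrow>
     (\<forall>i\<^sub>1\<in>I. \<forall>i\<^sub>2\<in>I. \<exists>j\<^sub>1\<in>I. \<exists>j\<^sub>2\<in>I.
        i\<^sub>1 \<oplus>\<^bsub>R\<^esub> j\<^sub>1 \<oplus>\<^bsub>R\<^esub> i\<^sub>1 \<otimes>\<^bsub>R\<^esub> j\<^sub>1 \<oplus>\<^bsub>R\<^esub> i\<^sub>2 \<otimes>\<^bsub>R\<^esub> j\<^sub>2 =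
        i\<^sub>2 \<oplus>\<^bsub>R\<^esub> j\<^sub>2 \<oplus>\<^bsub>R\<^esub> i\<^sub>1 \<otimes>\<^bsub>R\<^esub> j\<^sub>2 \<oplus>\<^bsub>R\<^esub> i\<^sub>2 \<otimes>\<^bsub>R\<^esub> j\<^sub>1)"

text \<open>The sum of a family of subsets: all finite sums with one term from each member chosen.\<close>

definition family_sum :: "'a ring \<Rightarrow> 'a set set \<Rightarrow> 'a set" where
  "family_sum R \<I> = {\<Oplus>\<^bsub>R\<^esub>I\<in>F. f I | F f. finite F \<and> F \<subseteq> \<I> \<and> (\<forall>I\<in>F. f I \<in> I)}"

definition jacobson_radical :: "'a ring \<Rightarrow> 'a set" where
  "jacobson_radical R = family_sum R {I. right_ideal R I \<and> right_semiregular R I}"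

section \<open>The radical classes\<close>

definition jacobson_class :: "'a ring set" where
  "jacobson_class = {R. hemiring R \<and> jacobson_radical R = carrier R}"

definition brown_mccoy_class :: "'a ring set" where
  "brown_mccoy_class = {R. hemiring R \<and> brown_mccoy_radical R = carrier R}"

definition J_s_class :: "'a ring set" where
  "J_s_class = {R. hemiring R \<and> J_s R = carrier R}"

section \<open>Independence of the carrier types\<close>

definition transport :: "('b \<Rightarrow> 'c) \<Rightarrow> ('a, 'b) module \<Rightarrow> ('a, 'c) module" where
  "transport \<phi> M = (let \<psi> = inv_into (carrier M) \<phi> in
     \<lparr> carrier = \<phi> ` carrier M,
       mult = (\<lambda>x y. \<phi> (\<psi> x \<otimes>\<^bsub>M\<^esub> \<psi> y)),
       one = \<phi> \<one>\<^bsub>M\<^esub>,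
       zero = \<phi> \<zero>\<^bsub>M\<^esub>,
       add = (\<lambda>x y. \<phi> (\<psi> x \<oplus>\<^bsub>M\<^esub> \<psi> y)),
       smult = (\<lambda>r x. \<phi> (r \<odot>\<^bsub>M\<^esub> \<psi> x)) \<rparr>)"

lemma transport_simps:
  assumes "inj_on \<phi> (carrier M)"
  shows "carrier (transport \<phi> M) = \<phi> ` carrier M"
    and "\<zero>\<^bsub>transport \<phi> M\<^esub> = \<phi> \<zero>\<^bsub>M\<^esub>"
    and "\<lbrakk> x \<in> carrier M; y \<in> carrier M \<rbrakk> \<Longrightarrow> \<phi> x \<oplus>\<^bsub>transport \<phi> M\<^esub> \<phi> y = \<phi> (x \<oplus>\<^bsub>M\<^esub> y)"
    and "\<lbrakk> x \<in> carrier M; y \<in> carrier M \<rbrakk> \<Longrightarrow> \<phi> x \<otimes>\<^bsub>transport \<phi> M\<^esub> \<phi> y = \<phi> (x \<otimes>\<^bsub>M\<^esub> y)"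
    and "x \<in> carrier M \<Longrightarrow> r \<odot>\<^bsub>transport \<phi> M\<^esub> \<phi> x = \<phi> (r \<odot>\<^bsub>M\<^esub> x)"
  using assms by (simp_all add: transport_def Let_def inv_into_f_f)

lemma abelian_monoid_iff:
  "abelian_monoid G \<longleftrightarrow>
     \<zero>\<^bsub>G\<^esub> \<in> carrier G \<and> (\<forall>x\<in>carrier G. \<forall>y\<in>carrier G. x \<oplus>\<^bsub>G\<^esub> y \<in> carrier G \<and> x \<oplus>\<^bsub>G\<^esub> y = y \<oplus>\<^bsub>G\<^esub> x) \<and>
     (\<forall>x\<in>carrier G. \<zero>\<^bsub>G\<^esub> \<oplus>\<^bsub>G\<^esub> x = x) \<and>
     (\<forall>x\<in>carrier G. \<forall>y\<in>carrier G. \<forall>z\<in>carrier G. (x \<oplus>\<^bsub>G\<^esub> y) \<oplus>\<^bsub>G\<^esub> z = x \<oplus>\<^bsub>G\<^esub> (y \<oplus>\<^bsub>G\<^esub> z))"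
  (is "?L \<longleftrightarrow> ?R")
proof
  assume ?L
  then interpret abelian_monoid G .
  show ?R by (auto simp: a_ac)
next
  assume ?R
  then show ?L by (intro abelian_monoidI) blast+
qed

lemma transport_abelian_monoid:
  assumes "inj_on \<phi> (carrier M)" and "abelian_monoid M"
  shows "abelian_monoid (transport \<phi> M)"
  using assms(2) unfolding abelian_monoid_iff
  by (auto simp: transport_simps[OF assms(1)])

lemma transport_left_semimodule:
  assumes inj: "inj_on \<phi> (carrier M)" and "left_semimodule R M"
  shows "left_semimodule R (transport \<phi> M)"
proof -
  interpret left_semimodule R M by fact
  have am: "abelian_monoid (transport \<phi> M)"
    by (rule transport_abelian_monoid[OF inj]) unfold_locales
  note [simp] = transport_simps[OF inj]
  show ?thesis
    apply (intro left_semimodule.intro left_semimodule_axioms.intro am)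
          apply (rule R.hemiring_axioms)
         apply (auto simp: smult_closed smult_assoc smult_r_distr smult_l_distr smult_r_null smult_l_null R.a_closed)
    done
qed

lemma transport_simple_semimodule:
  assumes inj: "inj_on \<phi> (carrier M)" and simple: "simple_semimodule R M"
  shows "simple_semimodule R (transport \<phi> M)"
proof -
  note [simp] = transport_simps[OF inj]
  have lsm: "left_semimodule R M" using simple by (simp add: simple_semimodule_def)
  interpret left_semimodule R M by fact
  have 1: "left_semimodule R (transport \<phi> M)"
    by (rule transport_left_semimodule[OF inj lsm])
  obtain r m where rm: "r \<in> carrier R" "m \<in> carrier M" "r \<odot>\<^bsub>M\<^esub> m \<noteq> \<zero>\<^bsub>M\<^esub>"
    using simple by (auto simp: simple_semimodule_def)
  then have 2: "\<exists>r\<in>carrier R. \<exists>m\<in>carrier (transport \<phi> M). r \<odot>\<^bsub>transport \<phi> M\<^esub> m \<noteq> \<zero>\<^bsub>transport \<phi> M\<^esub>"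
    using inj_onD[OF inj, of "r \<odot>\<^bsub>M\<^esub> m" "\<zero>\<^bsub>M\<^esub>"] by (auto simp: smult_closed)
  have 3: "N = {\<zero>\<^bsub>transport \<phi> M\<^esub>} \<or> N = carrier (transport \<phi> M)"
    if N: "subsemimodule R (transport \<phi> M) N" for N
  proof -
    let ?N = "{x \<in> carrier M. \<phi> x \<in> N}"
    have eq: "N = \<phi> ` ?N" using N by (auto simp: subsemimodule_def)
    have "subsemimodule R M ?N"
      unfolding subsemimodule_def
    proof (intro conjI ballI)
      fix x y assume "x \<in> ?N" "y \<in> ?N"
      then have "\<phi> x \<oplus>\<^bsub>transport \<phi> M\<^esub> \<phi> y \<in> N" using N by (auto simp only: subsemimodule_def)
      then show "x \<oplus>\<^bsub>M\<^esub> y \<in> ?N" using \<open>x \<in> ?N\<close> \<open>y \<in> ?N\<close> by auto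
    next
      fix r x assume "r \<in> carrier R" "x \<in> ?N"
      then have "r \<odot>\<^bsub>transport \<phi> M\<^esub> \<phi> x \<in> N" using N by (auto simp only: subsemimodule_def)
      then show "r \<odot>\<^bsub>M\<^esub> x \<in> ?N" using \<open>r \<in> carrier R\<close> \<open>x \<in> ?N\<close> by (auto simp: smult_closed)
    qed (use N in \<open>auto simp: subsemimodule_def\<close>)
    then have "?N = {\<zero>\<^bsub>M\<^esub>} \<or> ?N = carrier M" using simple by (auto simp: simple_semimodule_def)
    then have "\<phi> ` ?N = {\<phi> \<zero>\<^bsub>M\<^esub>} \<or> \<phi> ` ?N = \<phi> ` carrier M"
      by (elim disjE) (simp_all only: image_insert image_empty simp_thms)
    then show ?thesis by (simp only: transport_simps(1,2)[OF inj] eq[symmetric])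
  qed
  have 4: "\<rho> = Id_on (carrier (transport \<phi> M)) \<or> \<rho> = carrier (transport \<phi> M) \<times> carrier (transport \<phi> M)"
    if \<rho>: "semimodule_congruence R (transport \<phi> M) \<rho>" for \<rho>
  proof -
    let ?\<rho> = "{(x, y). x \<in> carrier M \<and> y \<in> carrier M \<and> (\<phi> x, \<phi> y) \<in> \<rho>}"
    have eqv: "equiv (\<phi> ` carrier M) \<rho>" using \<rho> by (simp add: semimodule_congruence_def)
    then have eq: "\<rho> = map_prod \<phi> \<phi> ` ?\<rho>"
      by (fastforce simp: equiv_def)
    have "equiv (carrier M) ?\<rho>"
    proof (rule equivI)
      show "refl_on (carrier M) ?\<rho>" using eqv by (auto simp: equiv_def refl_on_def)
      show "sym ?\<rho>" using eqv by (auto simp: equiv_def sym_def)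
      show "trans ?\<rho>"
        using eqv unfolding equiv_def trans_def by blast
    qed auto
    moreover have "(x \<oplus>\<^bsub>M\<^esub> y, x' \<oplus>\<^bsub>M\<^esub> y') \<in> ?\<rho>" if "(x, x') \<in> ?\<rho>" "(y, y') \<in> ?\<rho>" for x x' y y'
    proof -
      have "(\<phi> x \<oplus>\<^bsub>transport \<phi> M\<^esub> \<phi> y, \<phi> x' \<oplus>\<^bsub>transport \<phi> M\<^esub> \<phi> y') \<in> \<rho>"
        using \<rho> that by (fastforce simp only: semimodule_congruence_def)
      then show ?thesis using that by auto
    qed
    moreover have "(r \<odot>\<^bsub>M\<^esub> x, r \<odot>\<^bsub>M\<^esub> x') \<in> ?\<rho>" if "r \<in> carrier R" "(x, x') \<in> ?\<rho>" for r x x'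
    proof -
      have "(r \<odot>\<^bsub>transport \<phi> M\<^esub> \<phi> x, r \<odot>\<^bsub>transport \<phi> M\<^esub> \<phi> x') \<in> \<rho>"
        using \<rho> that by (fastforce simp only: semimodule_congruence_def)
      then show ?thesis using that by (auto simp: smult_closed)
    qed
    ultimately have "semimodule_congruence R M ?\<rho>"
      unfolding semimodule_congruence_def by blast
    then have "?\<rho> = Id_on (carrier M) \<or> ?\<rho> = carrier M \<times> carrier M"
      using simple by (simp add: simple_semimodule_def)
    moreover have "map_prod \<phi> \<phi> ` Id_on (carrier M) = Id_on (\<phi> ` carrier M)"
      by (auto simp: Id_on_def)
    moreover have "map_prod \<phi> \<phi> ` (carrier M \<times> carrier M) = \<phi> ` carrier M \<times> \<phi> ` carrier M"
      by auto
    ultimately have "map_prod \<phi> \<phi> ` ?\<rho> = Id_on (\<phi> ` carrier M) \<or>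
        map_prod \<phi> \<phi> ` ?\<rho> = \<phi> ` carrier M \<times> \<phi> ` carrier M"
      by (elim disjE) (simp_all only: simp_thms)
    then show ?thesis by (simp only: transport_simps(1)[OF inj] eq[symmetric])
  qed
  show ?thesis unfolding simple_semimodule_def using 1 2 3 4 by blast
qed

lemma simple_semimodule_cyclic:
  assumes simple: "simple_semimodule R M"
  shows "\<exists>m\<in>carrier M. (\<lambda>r. r \<odot>\<^bsub>M\<^esub> m) ` carrier R = carrier M"
proof -
  interpret left_semimodule R M using simple by (simp add: simple_semimodule_def)
  let ?N = "{m \<in> carrier M. \<forall>r\<in>carrier R. r \<odot>\<^bsub>M\<^esub> m = \<zero>\<^bsub>M\<^esub>}"
  have "subsemimodule R M ?N"
    by (auto simp: subsemimodule_def smult_closed smult_r_distr smult_r_null)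
  moreover have "?N \<noteq> carrier M" using simple by (auto simp: simple_semimodule_def)
  ultimately have N: "?N = {\<zero>\<^bsub>M\<^esub>}" using simple by (auto simp: simple_semimodule_def)
  obtain r m where rm: "r \<in> carrier R" "m \<in> carrier M" "r \<odot>\<^bsub>M\<^esub> m \<noteq> \<zero>\<^bsub>M\<^esub>"
    using simple by (auto simp: simple_semimodule_def)
  let ?C = "(\<lambda>r. r \<odot>\<^bsub>M\<^esub> m) ` carrier R"
  have "subsemimodule R M ?C"
    unfolding subsemimodule_def
  proof (intro conjI ballI)
    show "?C \<subseteq> carrier M" using rm by (auto simp: smult_closed)
    show "\<zero>\<^bsub>M\<^esub> \<in> ?C" using rm smult_l_null[of m] by (metis R.zero_closed image_eqI)
  next
    fix x y assume "x \<in> ?C" "y \<in> ?C"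
    then obtain a b where "a \<in> carrier R" "b \<in> carrier R" "x = a \<odot>\<^bsub>M\<^esub> m" "y = b \<odot>\<^bsub>M\<^esub> m" by auto
    then show "x \<oplus>\<^bsub>M\<^esub> y \<in> ?C" using rm smult_l_distr[of a b m] by (metis R.a_closed image_eqI)
  next
    fix s x assume "s \<in> carrier R" "x \<in> ?C"
    then obtain a where "a \<in> carrier R" "x = a \<odot>\<^bsub>M\<^esub> m" by auto
    then show "s \<odot>\<^bsub>M\<^esub> x \<in> ?C"
      using rm \<open>s \<in> carrier R\<close> smult_assoc[of s a m] by (metis R.m_closed image_eqI)
  qed
  moreover have "?C \<noteq> {\<zero>\<^bsub>M\<^esub>}" using rm by blast
  ultimately have "?C = carrier M" using simple unfolding simple_semimodule_def by blast
  then show ?thesis using rm by blast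
qed

lemma J_s_subset_annihilator:
  fixes R :: "'a ring" and M :: "('a, 'b) module"
  assumes simple: "simple_semimodule R M"
  shows "J_s R \<subseteq> annihilator R M"
proof -
  interpret left_semimodule R M using simple by (simp add: simple_semimodule_def)
  obtain m where m: "m \<in> carrier M" "(\<lambda>r. r \<odot>\<^bsub>M\<^esub> m) ` carrier R = carrier M"
    using simple_semimodule_cyclic[OF simple] by auto
  define \<phi> where "\<phi> x = {r \<in> carrier R. r \<odot>\<^bsub>M\<^esub> m = x}" for x
  have inj: "inj_on \<phi> (carrier M)"
  proof (rule inj_onI)
    fix x y assume *: "x \<in> carrier M" "y \<in> carrier M" "\<phi> x = \<phi> y"
    then obtain r where "r \<in> carrier R" "x = r \<odot>\<^bsub>M\<^esub> m" using m(2) by blast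
    then have "r \<in> \<phi> y" using * by (auto simp: \<phi>_def)
    then show "x = y" using \<open>x = _\<close> by (auto simp: \<phi>_def)
  qed
  note [simp] = transport_simps[OF inj]
  have "simple_semimodule R (transport \<phi> M)" by (rule transport_simple_semimodule[OF inj simple])
  then have "J_s R \<subseteq> annihilator R (transport \<phi> M)" by (auto simp: J_s_def)
  also have "\<dots> \<subseteq> annihilator R M"
    by (auto simp: annihilator_def inj_on_eq_iff[OF inj] smult_closed)
  finally show ?thesis .
qed

lemma upper_class_image:
  fixes R :: "'a ring" and S :: "'b ring"
  assumes R: "R \<in> upper_class" and im: "hom_image R S"
    and nz: "carrier S \<noteq> {\<zero>\<^bsub>S\<^esub>}" and simple: "ideal_simple S" and unity: "has_unity S"
  shows False
proof -
  obtain h where h: "h \<in> hemiring_hom R S" "h ` carrier R = carrier S"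
    using im by (auto simp: hom_image_def)
  interpret S: hemiring S using im by (simp add: hom_image_def)
  interpret R: hemiring R using R by (simp add: upper_class_def)
  define \<phi> where "\<phi> x = {r \<in> carrier R. h r = x}" for x
  have inj: "inj_on \<phi> (carrier S)"
  proof (rule inj_onI)
    fix x y assume *: "x \<in> carrier S" "y \<in> carrier S" "\<phi> x = \<phi> y"
    then obtain r where "r \<in> carrier R" "x = h r" using h(2) by blast
    then have "r \<in> \<phi> y" using * by (auto simp: \<phi>_def)
    then show "x = y" using \<open>x = _\<close> by (auto simp: \<phi>_def)
  qed
  define \<psi> where "\<psi> = inv_into (carrier S) \<phi>"
  define T :: "'a set ring" where
    "T = \<lparr> carrier = \<phi> ` carrier S,
       mult = (\<lambda>x y. \<phi> (\<psi> x \<otimes>\<^bsub>S\<^esub> \<psi> y)),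
       one = \<phi> \<one>\<^bsub>S\<^esub>,
       zero = \<phi> \<zero>\<^bsub>S\<^esub>,
       add = (\<lambda>x y. \<phi> (\<psi> x \<oplus>\<^bsub>S\<^esub> \<psi> y)) \<rparr>"
  have [simp]: "\<psi> (\<phi> x) = x" if "x \<in> carrier S" for x
    using inj that by (simp add: \<psi>_def)
  have T_simps [simp]: "carrier T = \<phi> ` carrier S" "\<zero>\<^bsub>T\<^esub> = \<phi> \<zero>\<^bsub>S\<^esub>" by (simp_all add: T_def)
  have ops: "\<phi> x \<oplus>\<^bsub>T\<^esub> \<phi> y = \<phi> (x \<oplus>\<^bsub>S\<^esub> y)" "\<phi> x \<otimes>\<^bsub>T\<^esub> \<phi> y = \<phi> (x \<otimes>\<^bsub>S\<^esub> y)"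
    if "x \<in> carrier S" "y \<in> carrier S" for x y
    using that by (simp_all add: T_def)
  have "abelian_monoid T"
    unfolding abelian_monoid_iff by (auto simp: ops S.a_ac)
  then have T: "hemiring T"
    by (intro hemiring.intro hemiring_axioms.intro)
      (auto simp: ops S.m_closed S.m_assoc S.l_distr S.r_distr S.l_null S.r_null)
  have hh: "h r \<in> carrier S" if "r \<in> carrier R" for r using h(2) that by auto
  have "(\<lambda>r. \<phi> (h r)) \<in> hemiring_hom R T"
    using h(1) by (auto simp: hemiring_hom_def hom_def ops hh)
  moreover have "(\<lambda>r. \<phi> (h r)) ` carrier R = carrier T" unfolding T_simps h(2)[symmetric] by (simp add: image_image)
  ultimately have "hom_image R T" using T by (auto simp: hom_image_def)
  moreover have "carrier T \<noteq> {\<zero>\<^bsub>T\<^esub>}"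
  proof
    assume "carrier T = {\<zero>\<^bsub>T\<^esub>}"
    then have "x = \<zero>\<^bsub>S\<^esub>" if "x \<in> carrier S" for x
      using inj_onD[OF inj, of x "\<zero>\<^bsub>S\<^esub>"] that by auto
    then show False using nz S.zero_closed by blast
  qed
  moreover have "ideal_simple T"
    unfolding ideal_simple_def
  proof (intro allI impI)
    fix I assume I: "hemiring_ideal T I"
    let ?I = "{x \<in> carrier S. \<phi> x \<in> I}"
    have eq: "I = \<phi> ` ?I" using I by (auto simp: hemiring_ideal_def)
    have "hemiring_ideal S ?I"
      unfolding hemiring_ideal_def
    proof (intro conjI ballI)
      fix x y assume *: "x \<in> ?I" "y \<in> ?I"
      then have "\<phi> x \<oplus>\<^bsub>T\<^esub> \<phi> y \<in> I" using I by (auto simp only: hemiring_ideal_def)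
      then show "x \<oplus>\<^bsub>S\<^esub> y \<in> ?I" using * by (auto simp: ops)
    next
      fix x r assume *: "x \<in> ?I" "r \<in> carrier S"
      then have "\<phi> r \<otimes>\<^bsub>T\<^esub> \<phi> x \<in> I \<and> \<phi> x \<otimes>\<^bsub>T\<^esub> \<phi> r \<in> I"
        using I by (auto simp: hemiring_ideal_def)
      then show "r \<otimes>\<^bsub>S\<^esub> x \<in> ?I" "x \<otimes>\<^bsub>S\<^esub> r \<in> ?I" using * by (auto simp: ops S.m_closed)
    qed (use I in \<open>auto simp: hemiring_ideal_def\<close>)
    then have "?I = {\<zero>\<^bsub>S\<^esub>} \<or> ?I = carrier S" using simple by (auto simp: ideal_simple_def)
    then have "\<phi> ` ?I = {\<phi> \<zero>\<^bsub>S\<^esub>} \<or> \<phi> ` ?I = \<phi> ` carrier S"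
      by (elim disjE) (simp_all only: image_insert image_empty simp_thms)
    then show "I = {\<zero>\<^bsub>T\<^esub>} \<or> I = carrier T"
      by (simp only: T_simps eq[symmetric])
  qed
  moreover have "has_unity T"
  proof -
    obtain e where "e \<in> carrier S" "\<forall>x\<in>carrier S. e \<otimes>\<^bsub>S\<^esub> x = x \<and> x \<otimes>\<^bsub>S\<^esub> e = x"
      using unity by (auto simp: has_unity_def)
    then show ?thesis by (auto simp: has_unity_def ops intro!: bexI[of _ e])
  qed
  ultimately show False using R unfolding upper_class_def by blast
qed

end

theory Submission
  imports Defs
begin

text \<open>
  Write \<open>M\<close> for the hemiring of \<open>n \<times> n\<close> matrices over \<open>R\<close>, and \<open>E i j a\<close> for the matrix whose only
  nonzero entry is \<open>a\<close>, at \<open>(i, j)\<close>.  Each radical class is first described without the radical,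
  and the description is then carried between \<open>R\<close> and \<open>M\<close>.  For the last two radicals the link is
  the rule \<open>E i j a \<cdot> A \<cdot> E k l b = E i l (a \<cdot> A j k \<cdot> b)\<close>.  As \<open>R\<close> need not have an identity,
  this shows an entry of \<open>A\<close> only after multiplication by elements of \<open>R\<close> on both sides, and the main
  point is then to get rid of these factors.

  Jacobson radical.  \<open>J(R) = R\<close> says exactly that \<open>R\<close> is right semiregular as a right ideal
  of itself (\<open>jacobson_radical_eq_carrier_iff\<close>).  A pair \<open>(a, b)\<close> plays the role of the formal
  difference \<open>a - b\<close>, and right semiregularity is right quasi-regularity of these differences for the
  circle operation \<open>x \<circ> y = x + y + xy\<close>.  As in ring theory, the
  associativity of \<open>\<circ>\<close> shows that adding an element of a right ideal of quasi-regular elements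
  keeps quasi-regularity (\<open>quasi_regular_pair_add\<close>).  This gives the description of \<open>J(R) = R\<close>, and it
  also builds up a matrix row by row, since the quasi-inverse of a matrix with a single nonzero row can
  be written down from the quasi-inverse of its diagonal entry (\<open>quasi_inverse_row\<close>).  The
  converse reads off the entry at \<open>(0, 0)\<close>.

  Brown-McCoy radical.  The radical is all of \<open>R\<close> iff \<open>R\<close> has no nonzero ideal-simple semiring as a
  homomorphic image (\<open>brown_mccoy_class_iff\<close>).  An ideal-simple semiring \<open>S\<close> that is an image of \<open>R\<close>
  yields the ideal-simple image \<open>M\<^sub>n(S)\<close> of \<open>M\<close>.  Conversely, if \<open>f\<close> maps \<open>M\<close> onto an ideal-simple
  semiring \<open>T\<close>, then \<open>a \<mapsto> f (E 0 0 a)\<close> maps \<open>R\<close> onto a subhemiring of \<open>T\<close>, the corner, which is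
  again an ideal-simple semiring.  Here a preimage of the identity of \<open>T\<close> makes up for the missing
  identity of \<open>R\<close> (\<open>image_unit_cancel\<close>).

  The radical \<open>J\<^sub>s\<close>.  \<open>J\<^sub>s(R) = R\<close> iff \<open>R\<close> has no simple semimodule.  If \<open>V\<close> is a simple
  \<open>R\<close>-semimodule, then the columns of length \<open>n\<close> over \<open>V\<close> form a simple \<open>M\<close>-semimodule
  (\<open>simple_column_module\<close>).  If \<open>N\<close> is a simple \<open>M\<close>-semimodule, then the elements
  \<open>E 0 j b \<cdot> x\<close> form a simple \<open>R\<close>-semimodule (\<open>simple_corner_module\<close>).  What replaces the identity
  here is that a simple semimodule is generated by each of its nonzero elements, and that
  its elements are separated by the action.
\<close>

section \<open>Matrix hemirings\<close>

context abelian_monoid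
begin

lemma finsum_commute:
  assumes "finite K" and "finite L" and "\<And>k l. k \<in> K \<Longrightarrow> l \<in> L \<Longrightarrow> f k l \<in> carrier G"
  shows "(\<Oplus>k\<in>K. \<Oplus>l\<in>L. f k l) = (\<Oplus>l\<in>L. \<Oplus>k\<in>K. f k l)"
  using assms(1,3)
proof (induction K rule: finite_induct)
  case (insert x K)
  have "(\<Oplus>l\<in>L. \<Oplus>k\<in>insert x K. f k l) = (\<Oplus>l\<in>L. f x l \<oplus> (\<Oplus>k\<in>K. f k l))"
    using insert by (intro finsum_cong) (auto simp: Pi_def simp_implies_def)
  also have "\<dots> = (\<Oplus>l\<in>L. f x l) \<oplus> (\<Oplus>l\<in>L. \<Oplus>k\<in>K. f k l)"
    using insert by (intro finsum_addf) auto
  finally show ?case using insert by (auto simp: Pi_def)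
qed simp

lemma finsum_delta:
  assumes "finite K" and "i \<in> K" and "a \<in> carrier G" and "\<And>k. k \<in> K \<Longrightarrow> f k = (if k = i then a else \<zero>)"
  shows "(\<Oplus>k\<in>K. f k) = a"
proof -
  have "(\<Oplus>k\<in>K. f k) = (\<Oplus>k\<in>K. if i = k then a else \<zero>)"
    using assms by (intro finsum_cong) (auto simp: simp_implies_def)
  also have "\<dots> = a" using assms by (intro add.finprod_singleton[of i K "\<lambda>_. a"]) auto
  finally show ?thesis .
qed

end

context hemiring
begin

lemma finsum_distr_left:
  assumes "finite K" and "f \<in> K \<rightarrow> carrier R" and "a \<in> carrier R"
  shows "a \<otimes> (\<Oplus>k\<in>K. f k) = (\<Oplus>k\<in>K. a \<otimes> f k)"
  using assms by (induction K rule: finite_induct) (auto simp: r_null r_distr m_closed Pi_def)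

lemma finsum_distr_right:
  assumes "finite K" and "f \<in> K \<rightarrow> carrier R" and "a \<in> carrier R"
  shows "(\<Oplus>k\<in>K. f k) \<otimes> a = (\<Oplus>k\<in>K. f k \<otimes> a)"
  using assms by (induction K rule: finite_induct) (auto simp: l_null l_distr m_closed Pi_def)

end

text \<open>
  The radicals are defined on the type \<^typ>\<open>'a ring\<close>, whereas \<^locale>\<open>hemiring\<close> admits extended records.
\<close>

locale plain_hemiring = hemiring R for R :: "'a ring" (structure)

locale matrices_over = plain_hemiring R for R :: "'a ring" (structure) +
  fixes n :: nat
begin

abbreviation "M \<equiv> matrix_hemiring n R"

text \<open>Without an identity in \<open>R\<close> there are no matrix units, only these multiples of them.\<close>

definition E :: "nat \<Rightarrow> nat \<Rightarrow> 'a \<Rightarrow> nat \<times> nat \<Rightarrow> 'a" where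
  "E i j a = (\<lambda>p\<in>{..<n} \<times> {..<n}. if p = (i, j) then a else \<zero>)"

definition part :: "(nat \<times> nat) set \<Rightarrow> (nat \<times> nat \<Rightarrow> 'a) \<Rightarrow> nat \<times> nat \<Rightarrow> 'a" where
  "part P A = (\<lambda>p\<in>{..<n} \<times> {..<n}. if p \<in> P then A p else \<zero>)"

lemma carrier_iff: "A \<in> carrier M \<longleftrightarrow> A \<in> ({..<n} \<times> {..<n}) \<rightarrow>\<^sub>E carrier R"
  by (simp add: matrix_hemiring_def)

lemma entry_closed [simp, intro]:
  "A \<in> carrier M \<Longrightarrow> i < n \<Longrightarrow> j < n \<Longrightarrow> A (i, j) \<in> carrier R"
  by (auto simp: carrier_iff)

lemma matrix_eqI:
  assumes "A \<in> carrier M" and "B \<in> carrier M" and "\<And>i j. i < n \<Longrightarrow> j < n \<Longrightarrow> A (i, j) = B (i, j)"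
  shows "A = B"
  by (rule PiE_ext[where k = "{..<n} \<times> {..<n}"]) (use assms in \<open>auto simp: carrier_iff\<close>)

lemma entry [simp]:
  assumes "i < n" and "j < n"
  shows "(A \<oplus>\<^bsub>M\<^esub> B) (i, j) = A (i, j) \<oplus> B (i, j)"
    and "(A \<otimes>\<^bsub>M\<^esub> B) (i, j) = (\<Oplus>k\<in>{..<n}. A (i, k) \<otimes> B (k, j))"
    and "\<zero>\<^bsub>M\<^esub> (i, j) = \<zero>"
    and "E k l a (i, j) = (if i = k \<and> j = l then a else \<zero>)"
    and "part P A (i, j) = (if (i, j) \<in> P then A (i, j) else \<zero>)"
  using assms by (simp_all add: matrix_hemiring_def E_def part_def)

lemma matrix_closed [simp, intro]:
  "A \<in> carrier M \<Longrightarrow> B \<in> carrier M \<Longrightarrow> A \<oplus>\<^bsub>M\<^esub> B \<in> carrier M"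
  "A \<in> carrier M \<Longrightarrow> B \<in> carrier M \<Longrightarrow> A \<otimes>\<^bsub>M\<^esub> B \<in> carrier M"
  "\<zero>\<^bsub>M\<^esub> \<in> carrier M"
  "a \<in> carrier R \<Longrightarrow> E i j a \<in> carrier M"
  "A \<in> carrier M \<Longrightarrow> part P A \<in> carrier M"
proof -
  have *: "(\<lambda>p\<in>{..<n} \<times> {..<n}. f p) \<in> carrier M"
    if "\<And>i j. i < n \<Longrightarrow> j < n \<Longrightarrow> f (i, j) \<in> carrier R" for f
    using that by (auto simp: carrier_iff)
  show "\<zero>\<^bsub>M\<^esub> \<in> carrier M"
    using *[of "\<lambda>_. \<zero>"] by (simp add: matrix_hemiring_def case_prod_unfold)
  show "E i j a \<in> carrier M" if "a \<in> carrier R"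
    using that unfolding E_def by (intro *) auto
  assume A: "A \<in> carrier M"
  then show "part P A \<in> carrier M"
    unfolding part_def by (intro *) auto
  assume B: "B \<in> carrier M"
  have "A \<oplus>\<^bsub>M\<^esub> B = (\<lambda>p\<in>{..<n} \<times> {..<n}. (A \<oplus>\<^bsub>M\<^esub> B) p)"
    and "A \<otimes>\<^bsub>M\<^esub> B = (\<lambda>p\<in>{..<n} \<times> {..<n}. (A \<otimes>\<^bsub>M\<^esub> B) p)"
    by (auto simp: matrix_hemiring_def fun_eq_iff)
  moreover have "(\<lambda>p\<in>{..<n} \<times> {..<n}. (A \<oplus>\<^bsub>M\<^esub> B) p) \<in> carrier M"
      "(\<lambda>p\<in>{..<n} \<times> {..<n}. (A \<otimes>\<^bsub>M\<^esub> B) p) \<in> carrier M"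
    using A B by (intro *; simp add: Pi_def m_closed)+
  ultimately show "A \<oplus>\<^bsub>M\<^esub> B \<in> carrier M" and "A \<otimes>\<^bsub>M\<^esub> B \<in> carrier M" by simp_all
qed

lemma matrix_assoc:
  assumes A: "A \<in> carrier M" and B: "B \<in> carrier M" and C: "C \<in> carrier M"
  shows "(A \<otimes>\<^bsub>M\<^esub> B) \<otimes>\<^bsub>M\<^esub> C = A \<otimes>\<^bsub>M\<^esub> (B \<otimes>\<^bsub>M\<^esub> C)"
proof (rule matrix_eqI)
  fix i j assume ij: "i < n" "j < n"
  have "((A \<otimes>\<^bsub>M\<^esub> B) \<otimes>\<^bsub>M\<^esub> C) (i, j) = (\<Oplus>l\<in>{..<n}. (\<Oplus>k\<in>{..<n}. A (i, k) \<otimes> B (k, l)) \<otimes> C (l, j))"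
    using ij A B C by (auto simp: simp_implies_def m_closed intro!: finsum_cong)
  also have "\<dots> = (\<Oplus>l\<in>{..<n}. \<Oplus>k\<in>{..<n}. A (i, k) \<otimes> B (k, l) \<otimes> C (l, j))"
    using ij A B C by (auto simp: simp_implies_def m_closed intro!: finsum_cong finsum_distr_right)
  also have "\<dots> = (\<Oplus>k\<in>{..<n}. \<Oplus>l\<in>{..<n}. A (i, k) \<otimes> B (k, l) \<otimes> C (l, j))"
    using ij A B C by (intro finsum_commute) (auto simp: m_closed)
  also have "\<dots> = (\<Oplus>k\<in>{..<n}. A (i, k) \<otimes> (\<Oplus>l\<in>{..<n}. B (k, l) \<otimes> C (l, j)))"
    using ij A B C
    by (intro finsum_cong) (auto simp: simp_implies_def m_closed m_assoc finsum_distr_left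
      intro!: finsum_cong)
  also have "\<dots> = (A \<otimes>\<^bsub>M\<^esub> (B \<otimes>\<^bsub>M\<^esub> C)) (i, j)"
    using ij A B C by (auto simp: simp_implies_def m_closed intro!: finsum_cong)
  finally show "((A \<otimes>\<^bsub>M\<^esub> B) \<otimes>\<^bsub>M\<^esub> C) (i, j) = (A \<otimes>\<^bsub>M\<^esub> (B \<otimes>\<^bsub>M\<^esub> C)) (i, j)" .
qed (use A B C in auto)

lemma matrix_distr:
  assumes A: "A \<in> carrier M" and B: "B \<in> carrier M" and C: "C \<in> carrier M"
  shows "(A \<oplus>\<^bsub>M\<^esub> B) \<otimes>\<^bsub>M\<^esub> C = A \<otimes>\<^bsub>M\<^esub> C \<oplus>\<^bsub>M\<^esub> B \<otimes>\<^bsub>M\<^esub> C"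
    and "C \<otimes>\<^bsub>M\<^esub> (A \<oplus>\<^bsub>M\<^esub> B) = C \<otimes>\<^bsub>M\<^esub> A \<oplus>\<^bsub>M\<^esub> C \<otimes>\<^bsub>M\<^esub> B"
proof -
  have "(\<Oplus>k\<in>{..<n}. (A \<oplus>\<^bsub>M\<^esub> B) (i, k) \<otimes> C (k, j)) =
      (\<Oplus>k\<in>{..<n}. A (i, k) \<otimes> C (k, j) \<oplus> B (i, k) \<otimes> C (k, j))" if "i < n" "j < n" for i j
    using that A B C by (intro finsum_cong') (simp_all add: Pi_def m_closed l_distr)
  then show "(A \<oplus>\<^bsub>M\<^esub> B) \<otimes>\<^bsub>M\<^esub> C = A \<otimes>\<^bsub>M\<^esub> C \<oplus>\<^bsub>M\<^esub> B \<otimes>\<^bsub>M\<^esub> C"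
    using A B C by (intro matrix_eqI) (simp_all add: Pi_def m_closed)
  have "(\<Oplus>k\<in>{..<n}. C (i, k) \<otimes> (A \<oplus>\<^bsub>M\<^esub> B) (k, j)) =
      (\<Oplus>k\<in>{..<n}. C (i, k) \<otimes> A (k, j) \<oplus> C (i, k) \<otimes> B (k, j))" if "i < n" "j < n" for i j
    using that A B C by (intro finsum_cong') (simp_all add: Pi_def m_closed r_distr)
  then show "C \<otimes>\<^bsub>M\<^esub> (A \<oplus>\<^bsub>M\<^esub> B) = C \<otimes>\<^bsub>M\<^esub> A \<oplus>\<^bsub>M\<^esub> C \<otimes>\<^bsub>M\<^esub> B"
    using A B C by (intro matrix_eqI) (simp_all add: Pi_def m_closed)
qed

lemma hemiring_matrix: "hemiring M"
proof (intro hemiring.intro hemiring_axioms.intro)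
  show "abelian_monoid M"
    unfolding abelian_monoid_iff by (auto intro!: matrix_eqI simp: a_ac)
next
  fix A assume A: "A \<in> carrier M"
  show "\<zero>\<^bsub>M\<^esub> \<otimes>\<^bsub>M\<^esub> A = \<zero>\<^bsub>M\<^esub>"
    using A by (intro matrix_eqI) (auto simp: l_null intro!: add.finprod_one_eqI)
  show "A \<otimes>\<^bsub>M\<^esub> \<zero>\<^bsub>M\<^esub> = \<zero>\<^bsub>M\<^esub>"
    using A by (intro matrix_eqI) (auto simp: r_null intro!: add.finprod_one_eqI)
qed (auto simp: matrix_assoc matrix_distr)

lemma E_zero: "E i j \<zero> = \<zero>\<^bsub>M\<^esub>"
  by (rule matrix_eqI) auto

lemma E_add:
  "a \<in> carrier R \<Longrightarrow> b \<in> carrier R \<Longrightarrow> E i j (a \<oplus> b) = E i j a \<oplus>\<^bsub>M\<^esub> E i j b"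
  by (rule matrix_eqI) auto

lemma E_mult_entry:
  assumes "a \<in> carrier R" and "A \<in> carrier M" and "p < n" and "q < n" and "j < n"
  shows "(E i j a \<otimes>\<^bsub>M\<^esub> A) (p, q) = (if p = i then a \<otimes> A (j, q) else \<zero>)"
proof (cases "p = i")
  case True
  have "(\<Oplus>k\<in>{..<n}. E i j a (i, k) \<otimes> A (k, q)) = a \<otimes> A (j, q)"
    using assms True by (intro finsum_delta[of _ j]) (auto simp: m_closed l_null)
  then show ?thesis using assms True by simp
next
  case False
  then show ?thesis using assms by (auto simp: l_null intro!: add.finprod_one_eqI)
qed

lemma mult_E_entry:
  assumes "a \<in> carrier R" and "A \<in> carrier M" and "p < n" and "q < n" and "i < n"
  shows "(A \<otimes>\<^bsub>M\<^esub> E i j a) (p, q) = (if q = j then A (p, i) \<otimes> a else \<zero>)"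
proof (cases "q = j")
  case True
  have "(\<Oplus>k\<in>{..<n}. A (p, k) \<otimes> E i j a (k, j)) = A (p, i) \<otimes> a"
    using assms True by (intro finsum_delta[of _ i]) (auto simp: m_closed r_null)
  then show ?thesis using assms True by simp
next
  case False
  then show ?thesis using assms by (auto simp: r_null intro!: add.finprod_one_eqI)
qed

lemma E_mult_E:
  assumes "a \<in> carrier R" and "b \<in> carrier R" and "j < n"
  shows "E i j a \<otimes>\<^bsub>M\<^esub> E k l b = (if j = k then E i l (a \<otimes> b) else \<zero>\<^bsub>M\<^esub>)"
  by (rule matrix_eqI) (use assms in \<open>auto simp del: entry(2) simp: E_mult_entry m_closed r_null\<close>)

text \<open>The rule by which a matrix is related to its entries throughout.\<close>

lemma E_mult_mult_E:
  assumes "a \<in> carrier R" and "b \<in> carrier R" and "A \<in> carrier M" and "j < n" and "k < n"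
  shows "E i j a \<otimes>\<^bsub>M\<^esub> A \<otimes>\<^bsub>M\<^esub> E k l b = E i l (a \<otimes> A (j, k) \<otimes> b)"
  by (rule matrix_eqI) (use assms in \<open>auto simp del: entry(2) simp: E_mult_entry mult_E_entry m_closed l_null\<close>)

lemma part_insert:
  assumes "A \<in> carrier M" and "i < n" and "j < n" and "(i, j) \<notin> P"
  shows "part (insert (i, j) P) A = part P A \<oplus>\<^bsub>M\<^esub> E i j (A (i, j))"
  by (rule matrix_eqI) (use assms in auto)

lemma part_all_indices: "A \<in> carrier M \<Longrightarrow> part ({..<n} \<times> {..<n}) A = A"
  by (rule matrix_eqI) auto

text \<open>
  A matrix is the sum of the \<open>E i j (A i j)\<close>, so a property compatible with addition can be checked
  on these summands.  The relational form covers at once membership in an additive submonoid, equality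
  under an additive map and relatedness by a congruence.
\<close>

lemma matrix_relation_induct:
  assumes A: "A \<in> carrier M" and B: "B \<in> carrier M" and zero: "rel \<zero>\<^bsub>M\<^esub> \<zero>\<^bsub>M\<^esub>"
    and add: "\<And>X Y X' Y'. \<lbrakk> X \<in> carrier M; Y \<in> carrier M; X' \<in> carrier M; Y' \<in> carrier M;
      rel X Y; rel X' Y' \<rbrakk> \<Longrightarrow> rel (X \<oplus>\<^bsub>M\<^esub> X') (Y \<oplus>\<^bsub>M\<^esub> Y')"
    and unit: "\<And>i j. i < n \<Longrightarrow> j < n \<Longrightarrow> rel (E i j (A (i, j))) (E i j (B (i, j)))"
  shows "rel A B"
proof -
  have "rel (part P A) (part P B)" if "finite P" "P \<subseteq> {..<n} \<times> {..<n}" for P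
    using that
  proof (induction P rule: finite_induct)
    case empty
    have "part {} X = \<zero>\<^bsub>M\<^esub>" if "X \<in> carrier M" for X
      using that by (intro matrix_eqI) auto
    then show ?case using zero A B by simp
  next
    case (insert p P)
    obtain i j where "p = (i, j)" "i < n" "j < n" using insert.prems by auto
    then show ?case using insert A B by (simp add: part_insert add unit)
  qed
  from this[of "{..<n} \<times> {..<n}"] show ?thesis using A B by (simp add: part_all_indices)
qed

end

section \<open>The Jacobson radical\<close>

text \<open>
  The pair \<open>(a, b)\<close> stands for the formal difference \<open>a - b\<close>.  Nothing is identified yet: this is the
  hemiring of expressions \<open>a + b\<epsilon>\<close> with \<open>\<epsilon>\<^sup>2 = 1\<close>.  The pairs that represent zero are the diagonal ones.
\<close>

definition pair_hemiring :: "'a ring \<Rightarrow> ('a \<times> 'a) ring" where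
  "pair_hemiring R =
     \<lparr> carrier = carrier R \<times> carrier R,
       mult = (\<lambda>(a, b) (c, d). (a \<otimes>\<^bsub>R\<^esub> c \<oplus>\<^bsub>R\<^esub> b \<otimes>\<^bsub>R\<^esub> d, a \<otimes>\<^bsub>R\<^esub> d \<oplus>\<^bsub>R\<^esub> b \<otimes>\<^bsub>R\<^esub> c)),
       one = (\<one>\<^bsub>R\<^esub>, \<zero>\<^bsub>R\<^esub>),
       zero = (\<zero>\<^bsub>R\<^esub>, \<zero>\<^bsub>R\<^esub>),
       add = (\<lambda>(a, b) (c, d). (a \<oplus>\<^bsub>R\<^esub> c, b \<oplus>\<^bsub>R\<^esub> d)) \<rparr>"

lemma pair_hemiring_simps [simp]:
  "carrier (pair_hemiring R) = carrier R \<times> carrier R"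
  "\<zero>\<^bsub>pair_hemiring R\<^esub> = (\<zero>\<^bsub>R\<^esub>, \<zero>\<^bsub>R\<^esub>)"
  "(a, b) \<oplus>\<^bsub>pair_hemiring R\<^esub> (c, d) = (a \<oplus>\<^bsub>R\<^esub> c, b \<oplus>\<^bsub>R\<^esub> d)"
  "(a, b) \<otimes>\<^bsub>pair_hemiring R\<^esub> (c, d) = (a \<otimes>\<^bsub>R\<^esub> c \<oplus>\<^bsub>R\<^esub> b \<otimes>\<^bsub>R\<^esub> d, a \<otimes>\<^bsub>R\<^esub> d \<oplus>\<^bsub>R\<^esub> b \<otimes>\<^bsub>R\<^esub> c)"
  by (simp_all add: pair_hemiring_def)

definition circle :: "'a ring \<Rightarrow> 'a \<Rightarrow> 'a \<Rightarrow> 'a" where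
  "circle R x y = x \<oplus>\<^bsub>R\<^esub> y \<oplus>\<^bsub>R\<^esub> x \<otimes>\<^bsub>R\<^esub> y"

text \<open>
  The equation in the definition of right semiregularity says that \<open>x \<circ> y\<close> is a diagonal pair, as
  \<open>quasi_regular_pair_iff\<close> makes explicit.  In contrast to right semiregularity of a right ideal,
  the quasi-inverse \<open>y\<close> may lie anywhere.
\<close>

definition quasi_regular_pair :: "'a ring \<Rightarrow> 'a \<times> 'a \<Rightarrow> bool" where
  "quasi_regular_pair R x \<longleftrightarrow>
     (\<exists>y\<in>carrier (pair_hemiring R). fst (circle (pair_hemiring R) x y) = snd (circle (pair_hemiring R) x y))"

context plain_hemiring
begin

lemma hemiring_pairs: "hemiring (pair_hemiring R)"
proof (intro hemiring.intro hemiring_axioms.intro)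
  show "abelian_monoid (pair_hemiring R)"
    unfolding abelian_monoid_iff by (auto simp: a_ac)
qed (auto simp: m_closed l_distr r_distr m_assoc l_null r_null a_ac)

lemma circle_closed: "x \<in> carrier R \<Longrightarrow> y \<in> carrier R \<Longrightarrow> circle R x y \<in> carrier R"
  by (simp add: circle_def m_closed)

lemma circle_assoc:
  assumes "x \<in> carrier R" and "y \<in> carrier R" and "z \<in> carrier R"
  shows "circle R (circle R x y) z = circle R x (circle R y z)"
  using assms by (simp add: circle_def m_closed l_distr r_distr m_assoc a_ac)

text \<open>
  The two ways to split a sum on the left of \<open>\<circ>\<close>: with \<open>x \<circ> y\<close> kept whole and
  \<open>k + ky\<close> left over, or with \<open>k \<circ> y\<close> kept whole and \<open>x + xy\<close> left over.
\<close>

lemma circle_add_left: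
  assumes "x \<in> carrier R" and "k \<in> carrier R" and "y \<in> carrier R"
  shows "circle R (x \<oplus> k) y = circle R x y \<oplus> (k \<oplus> k \<otimes> y)"
    and "circle R (x \<oplus> k) y = (x \<oplus> x \<otimes> y) \<oplus> circle R k y"
  using assms by (simp_all add: circle_def m_closed l_distr a_ac)

lemma quasi_regular_pair_iff:
  assumes "a \<in> carrier R" and "b \<in> carrier R"
  shows "quasi_regular_pair R (a, b) \<longleftrightarrow> (\<exists>c\<in>carrier R. \<exists>d\<in>carrier R.
    a \<oplus> c \<oplus> a \<otimes> c \<oplus> b \<otimes> d = b \<oplus> d \<oplus> a \<otimes> d \<oplus> b \<otimes> c)"
  using assms by (auto simp: quasi_regular_pair_def circle_def a_assoc m_closed)

lemma right_semiregular_carrier: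
  "right_semiregular R (carrier R) \<longleftrightarrow> (\<forall>x\<in>carrier R \<times> carrier R. quasi_regular_pair R x)"
  by (auto simp: right_semiregular_def quasi_regular_pair_iff)

lemma right_semiregular_quasi_regular_pair:
  assumes "right_ideal R I" and "right_semiregular R I" and "x \<in> I \<times> I"
  shows "quasi_regular_pair R x"
proof -
  obtain a b where ab: "x = (a, b)" "a \<in> I" "b \<in> I" using assms(3) by auto
  have "I \<subseteq> carrier R" using assms(1) by (simp add: right_ideal_def)
  then show ?thesis
    using assms(2) ab quasi_regular_pair_iff[of a b] unfolding right_semiregular_def by blast
qed

text \<open>
  If \<open>x \<circ> y\<close> is zero, then \<open>(x + k) \<circ> y\<close> is \<open>k + ky\<close>, which lies in the right ideal and so has a
  quasi-inverse \<open>z\<close>; by associativity \<open>y \<circ> z\<close> is a quasi-inverse of \<open>x + k\<close>.  For pairs, being zero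
  means being diagonal; the argument stays exact, without additive cancellation, because diagonal
  pairs are closed under addition and under multiplication by any pair.
\<close>

lemma quasi_regular_pair_add:
  assumes I: "right_ideal R I" and reg: "\<And>k. k \<in> I \<times> I \<Longrightarrow> quasi_regular_pair R k"
    and x: "x \<in> carrier R \<times> carrier R" "quasi_regular_pair R x" and k: "k \<in> I \<times> I"
  shows "quasi_regular_pair R (x \<oplus>\<^bsub>pair_hemiring R\<^esub> k)"
proof -
  let ?D = "pair_hemiring R"
  interpret D: plain_hemiring ?D by (intro plain_hemiring.intro hemiring_pairs)
  have x': "x \<in> carrier ?D" and k': "k \<in> carrier ?D"
    using x k I by (auto simp: right_ideal_def)
  obtain y where y: "y \<in> carrier ?D" and d: "fst (circle ?D x y) = snd (circle ?D x y)"
    using x(2) by (auto simp: quasi_regular_pair_def)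
  let ?k = "k \<oplus>\<^bsub>?D\<^esub> k \<otimes>\<^bsub>?D\<^esub> y"
  have kI: "?k \<in> I \<times> I"
    using k y I by (auto simp: right_ideal_def)
  then have kc: "?k \<in> carrier ?D" using I by (auto simp: right_ideal_def)
  obtain z where z: "z \<in> carrier ?D" and e: "fst (circle ?D ?k z) = snd (circle ?D ?k z)"
    using reg[OF kI] by (auto simp: quasi_regular_pair_def)
  define p where "p = fst (circle ?D x y)"
  have p: "circle ?D x y = (p, p)" by (metis p_def d prod.collapse)
  have pc: "p \<in> carrier R" using D.circle_closed[OF x' y] by (simp add: p)
  define q where "q = fst (circle ?D ?k z)"
  have q: "circle ?D ?k z = (q, q)" by (metis q_def e prod.collapse)
  have qc: "q \<in> carrier R" using D.circle_closed[OF kc z] by (simp add: q)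
  (* (x + k) o (y o z) = (p, p) + (p, p) z + (q, q), a sum of diagonal pairs *)
  have "circle ?D (x \<oplus>\<^bsub>?D\<^esub> k) (circle ?D y z) = circle ?D (circle ?D (x \<oplus>\<^bsub>?D\<^esub> k) y) z"
    using x' k' y z by (intro D.circle_assoc[symmetric] D.a_closed)
  also have "circle ?D (x \<oplus>\<^bsub>?D\<^esub> k) y = circle ?D x y \<oplus>\<^bsub>?D\<^esub> ?k"
    using x' k' y by (rule D.circle_add_left)
  also have "circle ?D (circle ?D x y \<oplus>\<^bsub>?D\<^esub> ?k) z =
      (circle ?D x y \<oplus>\<^bsub>?D\<^esub> circle ?D x y \<otimes>\<^bsub>?D\<^esub> z) \<oplus>\<^bsub>?D\<^esub> circle ?D ?k z"
    using D.circle_closed[OF x' y] kc z by (rule D.circle_add_left)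
  finally have *: "circle ?D (x \<oplus>\<^bsub>?D\<^esub> k) (circle ?D y z) =
      ((p, p) \<oplus>\<^bsub>?D\<^esub> (p, p) \<otimes>\<^bsub>?D\<^esub> z) \<oplus>\<^bsub>?D\<^esub> (q, q)"
    by (simp only: p q)
  have "fst (circle ?D (x \<oplus>\<^bsub>?D\<^esub> k) (circle ?D y z)) = snd (circle ?D (x \<oplus>\<^bsub>?D\<^esub> k) (circle ?D y z))"
    unfolding * using pc qc z by (cases z) (simp add: m_closed a_ac)
  moreover have "circle ?D y z \<in> carrier ?D" using y z by (rule D.circle_closed)
  ultimately show ?thesis unfolding quasi_regular_pair_def by blast
qed

lemma quasi_regular_pair_zero: "quasi_regular_pair R (\<zero>, \<zero>)"
  by (auto simp: quasi_regular_pair_iff)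

lemma quasi_regular_pair_add_finsum:
  assumes "finite F" and "\<And>I. I \<in> F \<Longrightarrow> right_ideal R I \<and> right_semiregular R I"
    and "\<And>I. I \<in> F \<Longrightarrow> f I \<in> I" and "\<And>I. I \<in> F \<Longrightarrow> g I \<in> I"
    and x: "x \<in> carrier R \<times> carrier R" "quasi_regular_pair R x"
  shows "quasi_regular_pair R (x \<oplus>\<^bsub>pair_hemiring R\<^esub> (\<Oplus>I\<in>F. f I, \<Oplus>I\<in>F. g I))"
  using assms(1-4)
proof (induction F rule: finite_induct)
  case empty
  then show ?case using x by (cases x) simp
next
  case (insert I F)
  have I: "right_ideal R I" "right_semiregular R I" "f I \<in> I" "g I \<in> I"
    using insert.prems by auto
  have sub: "J \<subseteq> carrier R" if "J \<in> insert I F" for J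
    using insert.prems(1)[OF that] by (simp add: right_ideal_def)
  have c: "f I \<in> carrier R" "g I \<in> carrier R"
    using sub[of I] I by auto
  have "f J \<in> carrier R" "g J \<in> carrier R" if "J \<in> F" for J
    using sub[of J] insert.prems(2)[of J] insert.prems(3)[of J] that by blast+
  then have F: "f \<in> F \<rightarrow> carrier R" "g \<in> F \<rightarrow> carrier R" by blast+
  have s: "x \<oplus>\<^bsub>pair_hemiring R\<^esub> (\<Oplus>I\<in>F. f I, \<Oplus>I\<in>F. g I) \<in> carrier R \<times> carrier R"
    using x F by (cases x) simp
  have "quasi_regular_pair R
      (x \<oplus>\<^bsub>pair_hemiring R\<^esub> (\<Oplus>I\<in>F. f I, \<Oplus>I\<in>F. g I) \<oplus>\<^bsub>pair_hemiring R\<^esub> (f I, g I))"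
    by (rule quasi_regular_pair_add[OF I(1) right_semiregular_quasi_regular_pair[OF I(1,2)]])
      (use s I insert.IH insert.prems in auto)
  then show ?case using insert.hyps F c x by (cases x) (simp add: a_ac)
qed

text \<open>
  Both components of a pair are finite sums of elements of right semiregular right ideals; the first
  component is built up from \<open>(\<zero>, \<zero>)\<close>, and then the second.
\<close>

lemma jacobson_radical_eq_carrier_iff:
  "jacobson_radical R = carrier R \<longleftrightarrow> right_semiregular R (carrier R)"
proof
  assume full: "jacobson_radical R = carrier R"
  have "quasi_regular_pair R (a, b)" if ab: "a \<in> carrier R" "b \<in> carrier R" for a b
  proof -
    let ?\<I> = "{I. right_ideal R I \<and> right_semiregular R I}"
    have "a \<in> family_sum R ?\<I>" and "b \<in> family_sum R ?\<I>"
      using full ab by (simp_all add: jacobson_radical_def)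
    then obtain F f G g where
      F: "a = (\<Oplus>I\<in>F. f I)" "finite F" "F \<subseteq> ?\<I>" "\<forall>I\<in>F. f I \<in> I" and
      G: "b = (\<Oplus>I\<in>G. g I)" "finite G" "G \<subseteq> ?\<I>" "\<forall>I\<in>G. g I \<in> I"
      by (auto simp: family_sum_def)
    have "quasi_regular_pair R ((\<zero>, \<zero>) \<oplus>\<^bsub>pair_hemiring R\<^esub> (\<Oplus>I\<in>F. f I, \<Oplus>I\<in>F. \<zero>))"
      using F quasi_regular_pair_zero
      by (intro quasi_regular_pair_add_finsum) (auto simp: right_ideal_def)
    then have "quasi_regular_pair R (a, \<zero>)" using F(1) ab by simp
    then have "quasi_regular_pair R ((a, \<zero>) \<oplus>\<^bsub>pair_hemiring R\<^esub> (\<Oplus>I\<in>G. \<zero>, \<Oplus>I\<in>G. g I))"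
      using G ab by (intro quasi_regular_pair_add_finsum) (auto simp: right_ideal_def)
    then show ?thesis using G(1) ab by simp
  qed
  then show "right_semiregular R (carrier R)" by (auto simp: right_semiregular_carrier)
next
  assume reg: "right_semiregular R (carrier R)"
  have ideal: "right_ideal R (carrier R)" by (auto simp: right_ideal_def m_closed)
  show "jacobson_radical R = carrier R"
  proof
    show "jacobson_radical R \<subseteq> carrier R"
    proof -
      have "f \<in> F \<rightarrow> carrier R"
        if "F \<subseteq> {I. right_ideal R I \<and> right_semiregular R I}" "\<forall>I\<in>F. f I \<in> I" for F f
        using that unfolding right_ideal_def by blast
      then show ?thesis by (auto simp: jacobson_radical_def family_sum_def)
    qed
    show "carrier R \<subseteq> jacobson_radical R"
    proof
      fix a assume a: "a \<in> carrier R"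
      then have "a = (\<Oplus>I\<in>{carrier R}. a)" by simp
      then show "a \<in> jacobson_radical R"
        unfolding jacobson_radical_def family_sum_def using a reg ideal
        by (intro CollectI exI[of _ "{carrier R}"] exI[of _ "\<lambda>_. a"]) auto
    qed
  qed
qed

text \<open>
  For ring elements with \<open>a + b + ab = 0\<close>, the element \<open>d = -(c + bc)\<close> solves \<open>c + d + ad = 0\<close>.  With
  pairs in place of differences, negation exchanges the two components.  For a matrix whose only
  nonzero row is row \<open>k\<close>, \<open>a\<close> is the entry on the diagonal, \<open>c\<close> any entry of the row and \<open>d\<close> the
  entry of the quasi-inverse in the same column.
\<close>

lemma quasi_inverse_row:
  assumes a: "a\<^sub>1 \<in> carrier R" "a\<^sub>2 \<in> carrier R" and b: "b\<^sub>1 \<in> carrier R" "b\<^sub>2 \<in> carrier R"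
    and c: "c\<^sub>1 \<in> carrier R" "c\<^sub>2 \<in> carrier R"
    and eq: "a\<^sub>1 \<oplus> b\<^sub>1 \<oplus> a\<^sub>1 \<otimes> b\<^sub>1 \<oplus> a\<^sub>2 \<otimes> b\<^sub>2 = a\<^sub>2 \<oplus> b\<^sub>2 \<oplus> a\<^sub>1 \<otimes> b\<^sub>2 \<oplus> a\<^sub>2 \<otimes> b\<^sub>1" (is "?p = ?q")
    and d: "d\<^sub>1 = c\<^sub>2 \<oplus> (b\<^sub>1 \<otimes> c\<^sub>2 \<oplus> b\<^sub>2 \<otimes> c\<^sub>1)" "d\<^sub>2 = c\<^sub>1 \<oplus> (b\<^sub>1 \<otimes> c\<^sub>1 \<oplus> b\<^sub>2 \<otimes> c\<^sub>2)"
  shows "c\<^sub>1 \<oplus> d\<^sub>1 \<oplus> a\<^sub>1 \<otimes> d\<^sub>1 \<oplus> a\<^sub>2 \<otimes> d\<^sub>2 = c\<^sub>2 \<oplus> d\<^sub>2 \<oplus> a\<^sub>1 \<otimes> d\<^sub>2 \<oplus> a\<^sub>2 \<otimes> d\<^sub>1"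
proof -
  have "c\<^sub>1 \<oplus> d\<^sub>1 \<oplus> a\<^sub>1 \<otimes> d\<^sub>1 \<oplus> a\<^sub>2 \<otimes> d\<^sub>2 = (c\<^sub>1 \<oplus> c\<^sub>2) \<oplus> (?p \<otimes> c\<^sub>2 \<oplus> ?q \<otimes> c\<^sub>1)"
    unfolding d using a b c by (simp add: m_closed l_distr r_distr m_assoc a_ac)
  also have "\<dots> = (c\<^sub>1 \<oplus> c\<^sub>2) \<oplus> (?q \<otimes> c\<^sub>2 \<oplus> ?p \<otimes> c\<^sub>1)"
    by (simp only: eq)
  also have "\<dots> = c\<^sub>2 \<oplus> d\<^sub>2 \<oplus> a\<^sub>1 \<otimes> d\<^sub>2 \<oplus> a\<^sub>2 \<otimes> d\<^sub>1"
    unfolding d using a b c by (simp add: m_closed l_distr r_distr m_assoc a_ac)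
  finally show ?thesis .
qed

end

context matrices_over
begin

definition row_ideal :: "nat \<Rightarrow> (nat \<times> nat \<Rightarrow> 'a) set" where
  "row_ideal k = {A \<in> carrier M. \<forall>i<n. \<forall>j<n. i \<noteq> k \<longrightarrow> A (i, j) = \<zero>}"

lemma row_ideal_mult_entry:
  assumes "A \<in> row_ideal k" and "B \<in> row_ideal k" and "k < n" and "i < n" and "j < n"
  shows "(A \<otimes>\<^bsub>M\<^esub> B) (i, j) = A (i, k) \<otimes> B (k, j)"
proof -
  have "(\<Oplus>l\<in>{..<n}. A (i, l) \<otimes> B (l, j)) = A (i, k) \<otimes> B (k, j)"
    using assms by (intro finsum_delta[of _ k]) (auto simp: row_ideal_def r_null m_closed)
  then show ?thesis using assms by simp
qed

lemma right_ideal_row: "right_ideal M (row_ideal k)"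
  unfolding right_ideal_def
proof (intro conjI ballI)
  fix A B assume A: "A \<in> row_ideal k" and B: "B \<in> carrier M"
  have "(\<Oplus>l\<in>{..<n}. A (i, l) \<otimes> B (l, j)) = \<zero>" if "i < n" "j < n" "i \<noteq> k" for i j
    using A B that by (intro add.finprod_one_eqI) (auto simp: row_ideal_def l_null)
  then show "A \<otimes>\<^bsub>M\<^esub> B \<in> row_ideal k" using A B by (auto simp: row_ideal_def)
qed (auto simp: row_ideal_def)

lemma quasi_regular_row_pair:
  assumes reg: "right_semiregular R (carrier R)" and k: "k < n"
    and X: "X \<in> row_ideal k \<times> row_ideal k"
  shows "quasi_regular_pair M X"
proof -
  interpret M: plain_hemiring M by (intro plain_hemiring.intro hemiring_matrix)
  obtain A\<^sub>1 A\<^sub>2 where XA: "X = (A\<^sub>1, A\<^sub>2)" and A: "A\<^sub>1 \<in> row_ideal k" "A\<^sub>2 \<in> row_ideal k"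
    using X by auto
  have Ac [simp]: "A\<^sub>1 \<in> carrier M" "A\<^sub>2 \<in> carrier M" using A by (auto simp: row_ideal_def)
  obtain b\<^sub>1 b\<^sub>2 where b [simp]: "b\<^sub>1 \<in> carrier R" "b\<^sub>2 \<in> carrier R" and
    eq: "A\<^sub>1 (k, k) \<oplus> b\<^sub>1 \<oplus> A\<^sub>1 (k, k) \<otimes> b\<^sub>1 \<oplus> A\<^sub>2 (k, k) \<otimes> b\<^sub>2 =
         A\<^sub>2 (k, k) \<oplus> b\<^sub>2 \<oplus> A\<^sub>1 (k, k) \<otimes> b\<^sub>2 \<oplus> A\<^sub>2 (k, k) \<otimes> b\<^sub>1"
    using reg k Ac unfolding right_semiregular_def by blast
  define B\<^sub>1 where "B\<^sub>1 = A\<^sub>2 \<oplus>\<^bsub>M\<^esub> (E k k b\<^sub>1 \<otimes>\<^bsub>M\<^esub> A\<^sub>2 \<oplus>\<^bsub>M\<^esub> E k k b\<^sub>2 \<otimes>\<^bsub>M\<^esub> A\<^sub>1)"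
  define B\<^sub>2 where "B\<^sub>2 = A\<^sub>1 \<oplus>\<^bsub>M\<^esub> (E k k b\<^sub>1 \<otimes>\<^bsub>M\<^esub> A\<^sub>1 \<oplus>\<^bsub>M\<^esub> E k k b\<^sub>2 \<otimes>\<^bsub>M\<^esub> A\<^sub>2)"
  have Bc [simp]: "B\<^sub>1 \<in> carrier M" "B\<^sub>2 \<in> carrier M" by (simp_all add: B\<^sub>1_def B\<^sub>2_def)
  have row_zero: "A\<^sub>1 (i, j) = \<zero>" "A\<^sub>2 (i, j) = \<zero>" if "i < n" "j < n" "i \<noteq> k" for i j
    using A that by (auto simp: row_ideal_def)
  have B_entry: "B\<^sub>1 (i, j) = (if i = k then A\<^sub>2 (k, j) \<oplus> (b\<^sub>1 \<otimes> A\<^sub>2 (k, j) \<oplus> b\<^sub>2 \<otimes> A\<^sub>1 (k, j)) else \<zero>)"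
    "B\<^sub>2 (i, j) = (if i = k then A\<^sub>1 (k, j) \<oplus> (b\<^sub>1 \<otimes> A\<^sub>1 (k, j) \<oplus> b\<^sub>2 \<otimes> A\<^sub>2 (k, j)) else \<zero>)"
    if "i < n" "j < n" for i j
    using that k by (simp_all del: entry(2) add: B\<^sub>1_def B\<^sub>2_def E_mult_entry row_zero)
  then have B: "B\<^sub>1 \<in> row_ideal k" "B\<^sub>2 \<in> row_ideal k" by (auto simp: row_ideal_def)
  have "A\<^sub>1 \<oplus>\<^bsub>M\<^esub> B\<^sub>1 \<oplus>\<^bsub>M\<^esub> A\<^sub>1 \<otimes>\<^bsub>M\<^esub> B\<^sub>1 \<oplus>\<^bsub>M\<^esub> A\<^sub>2 \<otimes>\<^bsub>M\<^esub> B\<^sub>2 =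
      A\<^sub>2 \<oplus>\<^bsub>M\<^esub> B\<^sub>2 \<oplus>\<^bsub>M\<^esub> A\<^sub>1 \<otimes>\<^bsub>M\<^esub> B\<^sub>2 \<oplus>\<^bsub>M\<^esub> A\<^sub>2 \<otimes>\<^bsub>M\<^esub> B\<^sub>1" (is "?L = ?R")
  proof (rule matrix_eqI)
    fix i j assume ij: "i < n" "j < n"
    note [simp] = row_ideal_mult_entry[OF A(1) B(1) k] row_ideal_mult_entry[OF A(1) B(2) k]
      row_ideal_mult_entry[OF A(2) B(1) k] row_ideal_mult_entry[OF A(2) B(2) k]
    show "?L (i, j) = ?R (i, j)"
    proof (cases "i = k")
      case True
      show ?thesis
        using quasi_inverse_row[OF _ _ b _ _ eq, of "A\<^sub>1 (k, j)" "A\<^sub>2 (k, j)" "B\<^sub>1 (k, j)" "B\<^sub>2 (k, j)"]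
          ij k True by (simp del: entry(2) add: B_entry)
    next
      case False
      then show ?thesis using ij k by (simp del: entry(2) add: row_zero B_entry l_null m_closed)
    qed
  qed simp_all
  then show ?thesis
    unfolding XA M.quasi_regular_pair_iff[OF Ac] using Bc by blast
qed

text \<open>A matrix is built up from zero by adding its rows one at a time, each from a right ideal of
  quasi-regular pairs.\<close>

lemma right_semiregular_matrix:
  assumes reg: "right_semiregular R (carrier R)"
  shows "right_semiregular M (carrier M)"
proof -
  interpret M: plain_hemiring M by (intro plain_hemiring.intro hemiring_matrix)
  have "quasi_regular_pair M (A, B)" if A: "A \<in> carrier M" and B: "B \<in> carrier M" for A B
  proof -
    let ?P = "\<lambda>m. {(i, j). i < m}"
    have "quasi_regular_pair M (part (?P m) A, part (?P m) B)" if "m \<le> n" for m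
      using that
    proof (induction m)
      case 0
      have "part (?P 0) X = \<zero>\<^bsub>M\<^esub>" if "X \<in> carrier M" for X
        using that by (intro matrix_eqI) auto
      then show ?case using M.quasi_regular_pair_zero A B by simp
    next
      case (Suc m)
      let ?row = "{(i, j). i = m}"
      have step: "part (?P (Suc m)) X = part (?P m) X \<oplus>\<^bsub>M\<^esub> part ?row X"
        and row: "part ?row X \<in> row_ideal m" if "X \<in> carrier M" for X
        using that by (auto intro!: matrix_eqI simp: row_ideal_def)
      have "quasi_regular_pair M ((part (?P m) A, part (?P m) B)
          \<oplus>\<^bsub>pair_hemiring M\<^esub> (part ?row A, part ?row B))"
        by (rule M.quasi_regular_pair_add[OF right_ideal_row[of m] quasi_regular_row_pair[OF reg, of m]])
          (use Suc A B row in auto)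
      then show ?case using A B by (simp add: step)
    qed
    from this[of n] moreover have "part (?P n) X = X" if "X \<in> carrier M" for X
      using that by (intro matrix_eqI) auto
    ultimately show ?thesis using A B by simp
  qed
  then show ?thesis by (auto simp: M.right_semiregular_carrier)
qed

text \<open>
  The entry at \<open>(0, 0)\<close> of a quasi-inverse of \<open>E 0 0 a\<close> is a quasi-inverse of \<open>a\<close>.
\<close>

lemma right_semiregular_entries:
  assumes n: "1 \<le> n" and reg: "right_semiregular M (carrier M)"
  shows "right_semiregular R (carrier R)"
  unfolding right_semiregular_def
proof (intro ballI)
  fix a\<^sub>1 a\<^sub>2 assume a: "a\<^sub>1 \<in> carrier R" "a\<^sub>2 \<in> carrier R"
  have z: "0 < n" using n by simp
  obtain B\<^sub>1 B\<^sub>2 where B: "B\<^sub>1 \<in> carrier M" "B\<^sub>2 \<in> carrier M" and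
    eq: "E 0 0 a\<^sub>1 \<oplus>\<^bsub>M\<^esub> B\<^sub>1 \<oplus>\<^bsub>M\<^esub> E 0 0 a\<^sub>1 \<otimes>\<^bsub>M\<^esub> B\<^sub>1 \<oplus>\<^bsub>M\<^esub> E 0 0 a\<^sub>2 \<otimes>\<^bsub>M\<^esub> B\<^sub>2 =
      E 0 0 a\<^sub>2 \<oplus>\<^bsub>M\<^esub> B\<^sub>2 \<oplus>\<^bsub>M\<^esub> E 0 0 a\<^sub>1 \<otimes>\<^bsub>M\<^esub> B\<^sub>2 \<oplus>\<^bsub>M\<^esub> E 0 0 a\<^sub>2 \<otimes>\<^bsub>M\<^esub> B\<^sub>1"
    using reg a unfolding right_semiregular_def by blast
  show "\<exists>b\<^sub>1\<in>carrier R. \<exists>b\<^sub>2\<in>carrier R.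
      a\<^sub>1 \<oplus> b\<^sub>1 \<oplus> a\<^sub>1 \<otimes> b\<^sub>1 \<oplus> a\<^sub>2 \<otimes> b\<^sub>2 = a\<^sub>2 \<oplus> b\<^sub>2 \<oplus> a\<^sub>1 \<otimes> b\<^sub>2 \<oplus> a\<^sub>2 \<otimes> b\<^sub>1"
    using fun_cong[OF eq, of "(0, 0)"] z a B
    by (intro bexI[of _ "B\<^sub>1 (0, 0)"] bexI[of _ "B\<^sub>2 (0, 0)"])
      (simp_all del: entry(2) add: E_mult_entry)
qed

lemma matric_jacobson:
  assumes "1 \<le> n"
  shows "R \<in> jacobson_class \<longleftrightarrow> M \<in> jacobson_class"
proof -
  interpret M: plain_hemiring M by (intro plain_hemiring.intro hemiring_matrix)
  show ?thesis
    unfolding jacobson_class_def mem_Collect_eq jacobson_radical_eq_carrier_iff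
      M.jacobson_radical_eq_carrier_iff
    using right_semiregular_matrix right_semiregular_entries[OF assms]
      hemiring_axioms hemiring_matrix by blast
qed

end

section \<open>The Brown-McCoy radical\<close>

lemma hemiring_homD:
  assumes "h \<in> hemiring_hom R S"
  shows "a \<in> carrier R \<Longrightarrow> h a \<in> carrier S"
    and "\<lbrakk> a \<in> carrier R; b \<in> carrier R \<rbrakk> \<Longrightarrow> h (a \<oplus>\<^bsub>R\<^esub> b) = h a \<oplus>\<^bsub>S\<^esub> h b"
    and "\<lbrakk> a \<in> carrier R; b \<in> carrier R \<rbrakk> \<Longrightarrow> h (a \<otimes>\<^bsub>R\<^esub> b) = h a \<otimes>\<^bsub>S\<^esub> h b"
    and "h \<zero>\<^bsub>R\<^esub> = \<zero>\<^bsub>S\<^esub>"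
  using assms by (auto simp: hemiring_hom_def hom_def)

lemma hemiring_homI:
  assumes "\<And>a. a \<in> carrier R \<Longrightarrow> h a \<in> carrier S"
    and "\<And>a b. \<lbrakk> a \<in> carrier R; b \<in> carrier R \<rbrakk> \<Longrightarrow> h (a \<oplus>\<^bsub>R\<^esub> b) = h a \<oplus>\<^bsub>S\<^esub> h b"
    and "\<And>a b. \<lbrakk> a \<in> carrier R; b \<in> carrier R \<rbrakk> \<Longrightarrow> h (a \<otimes>\<^bsub>R\<^esub> b) = h a \<otimes>\<^bsub>S\<^esub> h b"
    and "h \<zero>\<^bsub>R\<^esub> = \<zero>\<^bsub>S\<^esub>"
  shows "h \<in> hemiring_hom R S"
  using assms by (auto simp: hemiring_hom_def hom_def)

lemma hemiring_hom_finsum: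
  assumes "hemiring R" and "hemiring S" and h: "h \<in> hemiring_hom R S"
    and "finite K" and "f \<in> K \<rightarrow> carrier R"
  shows "h (\<Oplus>\<^bsub>R\<^esub>k\<in>K. f k) = (\<Oplus>\<^bsub>S\<^esub>k\<in>K. h (f k))"
proof -
  interpret R: hemiring R by fact
  interpret S: hemiring S by fact
  from assms(4,5) show ?thesis
  proof (induction K rule: finite_induct)
    case (insert k K)
    then have "f k \<in> carrier R" "(\<Oplus>\<^bsub>R\<^esub>k\<in>K. f k) \<in> carrier R" by auto
    moreover have "h (f i) \<in> carrier S" if "i \<in> insert k K" for i
      using insert.prems that by (intro hemiring_homD(1)[OF h]) auto
    ultimately show ?case using insert by (simp add: hemiring_homD[OF h] Pi_def)
  qed (simp add: hemiring_homD[OF h])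
qed

lemma hemiring_idealD:
  assumes "hemiring_ideal R I"
  shows "I \<subseteq> carrier R" and "\<zero>\<^bsub>R\<^esub> \<in> I" and "\<lbrakk> x \<in> I; y \<in> I \<rbrakk> \<Longrightarrow> x \<oplus>\<^bsub>R\<^esub> y \<in> I"
    and "\<lbrakk> x \<in> I; r \<in> carrier R \<rbrakk> \<Longrightarrow> r \<otimes>\<^bsub>R\<^esub> x \<in> I"
    and "\<lbrakk> x \<in> I; r \<in> carrier R \<rbrakk> \<Longrightarrow> x \<otimes>\<^bsub>R\<^esub> r \<in> I"
  using assms by (auto simp: hemiring_ideal_def)

lemma hemiring_ideal_image:
  assumes h: "h \<in> hemiring_hom R S" and surj: "h ` carrier R = carrier S"
    and I: "hemiring_ideal R I"
  shows "hemiring_ideal S (h ` I)"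
  unfolding hemiring_ideal_def
proof (intro conjI ballI)
  have [simp]: "x \<in> carrier R" if "x \<in> I" for x using hemiring_idealD(1)[OF I] that by auto
  show "h ` I \<subseteq> carrier S" by (auto simp: hemiring_homD(1)[OF h])
  show "\<zero>\<^bsub>S\<^esub> \<in> h ` I"
    using hemiring_idealD(2)[OF I] hemiring_homD(4)[OF h] by (metis image_eqI)
  fix x assume "x \<in> h ` I"
  then obtain a where a: "a \<in> I" "x = h a" by auto
  {
    fix y assume "y \<in> h ` I"
    then obtain b where b: "b \<in> I" "y = h b" by auto
    then have "x \<oplus>\<^bsub>S\<^esub> y = h (a \<oplus>\<^bsub>R\<^esub> b)" using a by (simp add: hemiring_homD(2)[OF h])
    then show "x \<oplus>\<^bsub>S\<^esub> y \<in> h ` I" using a b hemiring_idealD(3)[OF I] by auto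
  }
  {
    fix y assume "y \<in> carrier S"
    then obtain b where b: "b \<in> carrier R" "y = h b" using surj by auto
    then have "y \<otimes>\<^bsub>S\<^esub> x = h (b \<otimes>\<^bsub>R\<^esub> a)" "x \<otimes>\<^bsub>S\<^esub> y = h (a \<otimes>\<^bsub>R\<^esub> b)"
      using a by (simp_all add: hemiring_homD(3)[OF h])
    then show "y \<otimes>\<^bsub>S\<^esub> x \<in> h ` I" "x \<otimes>\<^bsub>S\<^esub> y \<in> h ` I" using a b hemiring_idealD(4,5)[OF I] by auto
  }
qed

text \<open>
  If \<open>h\<close> maps \<open>R\<close> onto a semiring \<open>S\<close> and \<open>R\<close> is the union of its ideals in the upper class, then
  one of them contains a preimage of the identity of \<open>S\<close>.  The image of that ideal contains the
  identity, hence is \<open>S\<close>.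
\<close>

lemma (in plain_hemiring) brown_mccoy_class_iff:
  "R \<in> brown_mccoy_class \<longleftrightarrow> R \<in> upper_class"
proof
  assume "R \<in> brown_mccoy_class"
  then have full: "brown_mccoy_radical R = carrier R" by (simp add: brown_mccoy_class_def)
  have False if im: "hom_image R S" and nz: "carrier S \<noteq> {\<zero>\<^bsub>S\<^esub>}" and
      simple: "ideal_simple S" and unity: "has_unity S" for S :: "'a set ring"
  proof -
    obtain h where h: "h \<in> hemiring_hom R S" and surj: "h ` carrier R = carrier S"
      using im by (auto simp: hom_image_def)
    obtain e where e: "e \<in> carrier S" "\<And>x. x \<in> carrier S \<Longrightarrow> e \<otimes>\<^bsub>S\<^esub> x = x"
      using unity by (auto simp: has_unity_def)
    obtain a where a: "a \<in> carrier R" "e = h a" using e(1) surj by auto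
    then obtain I where I: "hemiring_ideal R I" "ideal_as_hemiring R I \<in> upper_class" "a \<in> I"
      using full by (auto simp: brown_mccoy_radical_def)
    have sub: "I \<subseteq> carrier R" using I(1) by (rule hemiring_idealD)
    have "h \<in> hemiring_hom (ideal_as_hemiring R I) S"
      by (rule hemiring_homI) (simp_all add: ideal_as_hemiring_def hemiring_homD[OF h] subsetD[OF sub])
    moreover have "h ` I = carrier S"
    proof
      show "h ` I \<subseteq> carrier S" using sub surj by auto
      show "carrier S \<subseteq> h ` I"
      proof
        fix x assume x: "x \<in> carrier S"
        then obtain b where b: "b \<in> carrier R" "x = h b" using surj by auto
        have "x = h (a \<otimes> b)"
          using e(2)[OF x] a b by (simp add: hemiring_homD(3)[OF h])
        then show "x \<in> h ` I" using hemiring_idealD(5)[OF I(1) I(3) b(1)] by blast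
      qed
    qed
    ultimately have "hom_image (ideal_as_hemiring R I) S"
      using im by (auto simp: hom_image_def ideal_as_hemiring_def)
    then show False using upper_class_image[OF I(2)] nz simple unity by blast
  qed
  then show "R \<in> upper_class" unfolding upper_class_def using hemiring_axioms by blast
next
  assume R: "R \<in> upper_class"
  have "hemiring_ideal R (carrier R)" by (auto simp: hemiring_ideal_def m_closed)
  moreover have "ideal_as_hemiring R (carrier R) = R" by (simp add: ideal_as_hemiring_def)
  ultimately have "carrier R \<subseteq> brown_mccoy_radical R"
    using R by (auto simp: brown_mccoy_radical_def)
  moreover have "brown_mccoy_radical R \<subseteq> carrier R"
    by (auto simp: brown_mccoy_radical_def hemiring_ideal_def)
  ultimately show "R \<in> brown_mccoy_class"
    using hemiring_axioms by (auto simp: brown_mccoy_class_def)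
qed

context matrices_over
begin

lemma has_unity_matrix:
  assumes "has_unity R"
  shows "has_unity M"
proof -
  obtain e where e: "e \<in> carrier R" "\<And>x. x \<in> carrier R \<Longrightarrow> e \<otimes> x = x" "\<And>x. x \<in> carrier R \<Longrightarrow> x \<otimes> e = x"
    using assms by (auto simp: has_unity_def)
  let ?I = "\<lambda>p\<in>{..<n} \<times> {..<n}. if fst p = snd p then e else \<zero>"
  have I: "?I \<in> carrier M" using e by (auto simp: carrier_iff)
  have I_entry: "?I (i, j) = (if i = j then e else \<zero>)" if "i < n" "j < n" for i j
    using that by simp
  have "?I \<otimes>\<^bsub>M\<^esub> A = A \<and> A \<otimes>\<^bsub>M\<^esub> ?I = A" if A: "A \<in> carrier M" for A
  proof -
    have "(\<Oplus>k\<in>{..<n}. ?I (i, k) \<otimes> A (k, j)) = A (i, j)" if "i < n" "j < n" for i j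
      using A that by (intro finsum_delta[of _ i]) (auto simp: e l_null)
    moreover have "(\<Oplus>k\<in>{..<n}. A (i, k) \<otimes> ?I (k, j)) = A (i, j)" if "i < n" "j < n" for i j
      using A that by (intro finsum_delta[of _ j]) (auto simp: e r_null)
    ultimately show ?thesis
      using A I by (intro conjI matrix_eqI) (simp_all only: entry matrix_closed)
  qed
  then show ?thesis using I unfolding has_unity_def by blast
qed

text \<open>
  The \<open>a\<close> with \<open>E 0 0 a\<close> in the ideal \<open>K\<close> form an ideal of \<open>R\<close>, and multiplication by multiples
  of matrix units, with the identity as coefficient, moves any entry to position \<open>(0, 0)\<close> and back.
\<close>

lemma ideal_simple_matrix:
  assumes n: "0 < n" and unity: "has_unity R" and simple: "ideal_simple R"
  shows "ideal_simple M"
  unfolding ideal_simple_def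
proof (intro allI impI)
  fix K assume K: "hemiring_ideal M K"
  obtain e where e: "e \<in> carrier R" "\<And>x. x \<in> carrier R \<Longrightarrow> e \<otimes> x = x" "\<And>x. x \<in> carrier R \<Longrightarrow> x \<otimes> e = x"
    using unity by (auto simp: has_unity_def)
  have Kc: "A \<in> carrier M" if "A \<in> K" for A using hemiring_idealD(1)[OF K] that by auto
  let ?I = "{a \<in> carrier R. E 0 0 a \<in> K}"
  have "hemiring_ideal R ?I"
    unfolding hemiring_ideal_def
  proof (intro conjI ballI)
    fix a b assume "a \<in> ?I" "b \<in> ?I"
    then show "a \<oplus> b \<in> ?I" using hemiring_idealD(3)[OF K] by (simp add: E_add)
  next
    fix a b assume *: "a \<in> ?I" "b \<in> carrier R"
    then have "E 0 0 b \<otimes>\<^bsub>M\<^esub> E 0 0 a \<in> K" "E 0 0 a \<otimes>\<^bsub>M\<^esub> E 0 0 b \<in> K"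
      using hemiring_idealD(4,5)[OF K] by auto
    then show "b \<otimes> a \<in> ?I" "a \<otimes> b \<in> ?I" using * n by (simp_all add: E_mult_E m_closed)
  qed (use hemiring_idealD(2)[OF K] in \<open>auto simp: E_zero\<close>)
  then consider "?I = {\<zero>}" | "?I = carrier R" using simple by (auto simp: ideal_simple_def)
  then show "K = {\<zero>\<^bsub>M\<^esub>} \<or> K = carrier M"
  proof cases
    case 1
    have "A = \<zero>\<^bsub>M\<^esub>" if A: "A \<in> K" for A
    proof (rule matrix_eqI)
      fix i j assume ij: "i < n" "j < n"
      have "E 0 i e \<otimes>\<^bsub>M\<^esub> A \<otimes>\<^bsub>M\<^esub> E j 0 e \<in> K"
        using A e hemiring_idealD(4,5)[OF K] by auto
      then have "A (i, j) \<in> ?I"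
        using ij e Kc[OF A] by (simp add: E_mult_mult_E)
      then show "A (i, j) = \<zero>\<^bsub>M\<^esub> (i, j)" using 1 ij by simp
    qed (use Kc A in auto)
    then have "K = {\<zero>\<^bsub>M\<^esub>}" using hemiring_idealD(2)[OF K] by blast
    then show ?thesis ..
  next
    case 2
    have E00: "E 0 0 e \<in> K" using 2 e by auto
    have "A \<in> K" if A: "A \<in> carrier M" for A
    proof (rule matrix_relation_induct[where rel = "\<lambda>X Y. X \<in> K" and B = A])
      fix i j assume ij: "i < n" "j < n"
      have "E i 0 e \<otimes>\<^bsub>M\<^esub> E 0 0 e \<otimes>\<^bsub>M\<^esub> E 0 j (A (i, j)) \<in> K"
        using A e(1) ij
        by (intro hemiring_idealD(5)[OF K hemiring_idealD(4)[OF K E00]]) simp_all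
      then show "E i j (A (i, j)) \<in> K" using A e ij n by (simp add: E_mult_E)
    qed (use A in \<open>simp_all add: hemiring_idealD(2,3)[OF K]\<close>)
    then have "K = carrier M" using Kc by blast
    then show ?thesis ..
  qed
qed

lemma matrix_nonzero:
  assumes n: "0 < n" and "carrier R \<noteq> {\<zero>}"
  shows "carrier M \<noteq> {\<zero>\<^bsub>M\<^esub>}"
proof
  assume *: "carrier M = {\<zero>\<^bsub>M\<^esub>}"
  obtain a where a: "a \<in> carrier R" "a \<noteq> \<zero>" using assms by auto
  have "E 0 0 a \<in> carrier M" using a by simp
  then have "E 0 0 a = \<zero>\<^bsub>M\<^esub>" unfolding * by simp
  then have "E 0 0 a (0, 0) = \<zero>\<^bsub>M\<^esub> (0, 0)" by simp
  then show False using a n by simp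
qed

end

lemma hom_image_matrix:
  assumes "hemiring R" and im: "hom_image R S"
  shows "hom_image (matrix_hemiring n R) (matrix_hemiring n S)"
proof -
  obtain h where h: "h \<in> hemiring_hom R S" and surj: "h ` carrier R = carrier S"
    using im by (auto simp: hom_image_def)
  interpret R: matrices_over R n
    using assms(1) by (intro matrices_over.intro plain_hemiring.intro)
  interpret S: matrices_over S n
    using im by (intro matrices_over.intro plain_hemiring.intro) (simp add: hom_image_def)
  let ?h = "\<lambda>A. \<lambda>p\<in>{..<n} \<times> {..<n}. h (A p)"
  note [simp] = hemiring_homD[OF h]
  have hc: "?h A \<in> carrier S.M" if "A \<in> carrier R.M" for A
    using that by (auto simp: S.carrier_iff)
  have h_entry: "?h A (i, j) = h (A (i, j))" if "i < n" "j < n" for A i j using that by simp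
  have "?h \<in> hemiring_hom R.M S.M"
  proof (rule hemiring_homI)
    fix A B assume A: "A \<in> carrier R.M" and B: "B \<in> carrier R.M"
    show "?h (A \<oplus>\<^bsub>R.M\<^esub> B) = ?h A \<oplus>\<^bsub>S.M\<^esub> ?h B"
      using A B by (intro S.matrix_eqI hc S.matrix_closed R.matrix_closed) auto
    have "h (\<Oplus>\<^bsub>R\<^esub>k\<in>{..<n}. A (i, k) \<otimes>\<^bsub>R\<^esub> B (k, j)) =
        (\<Oplus>\<^bsub>S\<^esub>k\<in>{..<n}. ?h A (i, k) \<otimes>\<^bsub>S\<^esub> ?h B (k, j))" if "i < n" "j < n" for i j
    proof -
      have "h (\<Oplus>\<^bsub>R\<^esub>k\<in>{..<n}. A (i, k) \<otimes>\<^bsub>R\<^esub> B (k, j)) =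
          (\<Oplus>\<^bsub>S\<^esub>k\<in>{..<n}. h (A (i, k) \<otimes>\<^bsub>R\<^esub> B (k, j)))"
        using A B that R.hemiring_axioms S.hemiring_axioms
        by (intro hemiring_hom_finsum[OF _ _ h]) (auto simp: R.m_closed)
      also have "\<dots> = (\<Oplus>\<^bsub>S\<^esub>k\<in>{..<n}. ?h A (i, k) \<otimes>\<^bsub>S\<^esub> ?h B (k, j))"
        using A B that by (intro S.finsum_cong') (auto simp: S.m_closed)
      finally show ?thesis .
    qed
    then show "?h (A \<otimes>\<^bsub>R.M\<^esub> B) = ?h A \<otimes>\<^bsub>S.M\<^esub> ?h B"
      using A B by (intro S.matrix_eqI hc S.matrix_closed R.matrix_closed)
        (simp_all only: h_entry R.entry S.entry)
  next
    show "?h \<zero>\<^bsub>R.M\<^esub> = \<zero>\<^bsub>S.M\<^esub>"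
      by (intro S.matrix_eqI hc S.matrix_closed R.matrix_closed) auto
  qed (rule hc)
  moreover have "?h ` carrier R.M = carrier S.M"
  proof
    show "?h ` carrier R.M \<subseteq> carrier S.M" using hc by auto
    show "carrier S.M \<subseteq> ?h ` carrier R.M"
    proof
      fix B assume B: "B \<in> carrier S.M"
      let ?A = "\<lambda>p\<in>{..<n} \<times> {..<n}. inv_into (carrier R) h (B p)"
      have A: "?A \<in> carrier R.M"
        using B by (auto simp: R.carrier_iff surj intro!: inv_into_into)
      have "B = ?h ?A"
        by (rule S.matrix_eqI[OF B hc[OF A]]) (use B in \<open>simp add: surj f_inv_into_f\<close>)
      then show "B \<in> ?h ` carrier R.M" using A by blast
    qed
  qed
  ultimately show ?thesis using S.hemiring_matrix by (auto simp: hom_image_def)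
qed

locale matrix_semiring_image = matrices_over R n + T: hemiring T
  for R :: "'a ring" (structure) and n and T :: "'b ring" +
  fixes f :: "(nat \<times> nat \<Rightarrow> 'a) \<Rightarrow> 'b"
  assumes pos: "0 < n" and hom: "f \<in> hemiring_hom M T" and surj: "f ` carrier M = carrier T"
    and unity: "has_unity T"
begin

lemmas f_simps [simp] = hemiring_homD[OF hom]

definition identity_lift :: "(nat \<times> nat \<Rightarrow> 'a) \<Rightarrow> bool" where
  "identity_lift U \<longleftrightarrow> U \<in> carrier M \<and> (\<forall>x\<in>carrier T. f U \<otimes>\<^bsub>T\<^esub> x = x \<and> x \<otimes>\<^bsub>T\<^esub> f U = x)"

lemma identity_liftD:
  assumes "identity_lift U"
  shows "U \<in> carrier M" and "x \<in> carrier T \<Longrightarrow> f U \<otimes>\<^bsub>T\<^esub> x = x" and "x \<in> carrier T \<Longrightarrow> x \<otimes>\<^bsub>T\<^esub> f U = x"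
  using assms by (auto simp: identity_lift_def)

lemma identity_lift_exists: "\<exists>U. identity_lift U"
proof -
  obtain e where e: "e \<in> carrier T" "\<forall>x\<in>carrier T. e \<otimes>\<^bsub>T\<^esub> x = x \<and> x \<otimes>\<^bsub>T\<^esub> e = x"
    using unity by (auto simp: has_unity_def)
  then obtain U where "U \<in> carrier M" "e = f U" using surj by auto
  then show ?thesis using e by (auto simp: identity_lift_def)
qed

lemma image_eq_by_entries:
  assumes "A \<in> carrier M" and "B \<in> carrier M"
    and "\<And>i j. i < n \<Longrightarrow> j < n \<Longrightarrow> f (E i j (A (i, j))) = f (E i j (B (i, j)))"
  shows "f A = f B"
  by (rule matrix_relation_induct[where rel = "\<lambda>X Y. f X = f Y"]) (use assms in auto)

text \<open>
  Let \<open>f U\<close> be the identity of \<open>T\<close>.  Then \<open>f (E k l a) = f (U \<cdot> E k l a \<cdot> U)\<close>, and the entries of the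
  matrix \<open>U \<cdot> E k l a \<cdot> U\<close> are products \<open>c \<cdot> a \<cdot> d\<close> with entries \<open>c\<close>, \<open>d\<close> of \<open>U\<close>.
\<close>

lemma image_unit_cancel:
  assumes a: "a \<in> carrier R" and b: "b \<in> carrier R" and kl: "k < n" "l < n"
    and eq: "\<And>c d i j. \<lbrakk> c \<in> carrier R; d \<in> carrier R; i < n; j < n \<rbrakk> \<Longrightarrow>
      f (E i j (c \<otimes> a \<otimes> d)) = f (E i j (c \<otimes> b \<otimes> d))"
  shows "f (E k l a) = f (E k l b)"
proof -
  obtain U where U: "identity_lift U" using identity_lift_exists by blast
  note [simp] = identity_liftD[OF U]
  have sandwich: "f (E k l x) = f (U \<otimes>\<^bsub>M\<^esub> E k l x \<otimes>\<^bsub>M\<^esub> U)" if "x \<in> carrier R" for x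
    using that by simp
  have sandwich_entry: "(U \<otimes>\<^bsub>M\<^esub> E k l x \<otimes>\<^bsub>M\<^esub> U) (i, j) = U (i, k) \<otimes> x \<otimes> U (l, j)"
    if "x \<in> carrier R" "i < n" "j < n" for x i j
  proof -
    have "(\<Oplus>p\<in>{..<n}. (U \<otimes>\<^bsub>M\<^esub> E k l x) (i, p) \<otimes> U (p, j)) = U (i, k) \<otimes> x \<otimes> U (l, j)"
      using that kl by (intro finsum_delta[of _ l])
        (auto simp del: entry(2) simp: mult_E_entry m_closed l_null)
    then show ?thesis using that by (simp add: entry(2)[of i j "U \<otimes>\<^bsub>M\<^esub> E k l x"] del: entry(2))
  qed
  have "f (U \<otimes>\<^bsub>M\<^esub> E k l a \<otimes>\<^bsub>M\<^esub> U) = f (U \<otimes>\<^bsub>M\<^esub> E k l b \<otimes>\<^bsub>M\<^esub> U)"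
    by (rule image_eq_by_entries)
      (use a b kl in \<open>simp_all del: entry(2) f_simps add: sandwich_entry eq\<close>)
  then show ?thesis by (simp only: sandwich[OF a] sandwich[OF b])
qed

text \<open>
  The image of \<open>a \<mapsto> f (E 0 0 a)\<close>.  When \<open>R\<close> has an identity, this is the corner \<open>e T e\<close> for the image
  \<open>e\<close> of the matrix unit at \<open>(0, 0)\<close>.
\<close>

definition corner :: "'b ring" where
  "corner = T\<lparr>carrier := (\<lambda>a. f (E 0 0 a)) ` carrier R\<rparr>"

lemma corner_simps [simp]:
  "carrier corner = (\<lambda>a. f (E 0 0 a)) ` carrier R" "\<zero>\<^bsub>corner\<^esub> = \<zero>\<^bsub>T\<^esub>"
  "x \<oplus>\<^bsub>corner\<^esub> y = x \<oplus>\<^bsub>T\<^esub> y" "x \<otimes>\<^bsub>corner\<^esub> y = x \<otimes>\<^bsub>T\<^esub> y"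
  by (simp_all add: corner_def)

lemma corner_map:
  "\<lbrakk> a \<in> carrier R; b \<in> carrier R \<rbrakk> \<Longrightarrow> f (E 0 0 a) \<oplus>\<^bsub>T\<^esub> f (E 0 0 b) = f (E 0 0 (a \<oplus> b))"
  "\<lbrakk> a \<in> carrier R; b \<in> carrier R \<rbrakk> \<Longrightarrow> f (E 0 0 a) \<otimes>\<^bsub>T\<^esub> f (E 0 0 b) = f (E 0 0 (a \<otimes> b))"
  "f (E 0 0 \<zero>) = \<zero>\<^bsub>T\<^esub>"
  using pos f_simps(3)[of "E 0 0 a" "E 0 0 b"] by (simp_all add: E_add E_zero E_mult_E del: f_simps(3))

lemma corner_zero_mem: "\<zero>\<^bsub>T\<^esub> \<in> (\<lambda>a. f (E 0 0 a)) ` carrier R"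
  using corner_map(3) by (metis image_eqI zero_closed)

lemma hemiring_corner: "hemiring corner"
proof (intro hemiring.intro hemiring_axioms.intro)
  show "abelian_monoid corner"
    unfolding abelian_monoid_iff by (auto simp: corner_map corner_zero_mem a_ac)
next
  fix x assume "x \<in> carrier corner"
  then have "x \<in> carrier T" by auto
  then show "\<zero>\<^bsub>corner\<^esub> \<otimes>\<^bsub>corner\<^esub> x = \<zero>\<^bsub>corner\<^esub>" "x \<otimes>\<^bsub>corner\<^esub> \<zero>\<^bsub>corner\<^esub> = \<zero>\<^bsub>corner\<^esub>"
    by (simp_all add: T.l_null T.r_null)
qed (auto simp: corner_map m_closed m_assoc l_distr r_distr)

lemma hom_image_corner: "hom_image R corner"
proof -
  have "(\<lambda>a. f (E 0 0 a)) \<in> hemiring_hom R corner"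
    by (rule hemiring_homI) (simp_all add: corner_map)
  then show ?thesis using hemiring_corner by (auto simp: hom_image_def)
qed

text \<open>
  The element \<open>E i 0 c \<cdot> U \<cdot> E 0 j d = E i j (c \<cdot> U 0 0 \<cdot> d)\<close> has the same image under \<open>f\<close> as
  \<open>E i 0 c \<cdot> E 0 j d\<close>, so that \<open>U 0 0\<close> can be omitted between two factors from \<open>R\<close>; the outer factors
  are then removed by \<open>image_unit_cancel\<close>.
\<close>

lemma corner_identity:
  assumes U: "identity_lift U" and a: "a \<in> carrier R"
  shows "f (E 0 0 (U (0, 0))) \<otimes>\<^bsub>T\<^esub> f (E 0 0 a) = f (E 0 0 a)"
    and "f (E 0 0 a) \<otimes>\<^bsub>T\<^esub> f (E 0 0 (U (0, 0))) = f (E 0 0 a)"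
proof -
  note U [simp] = identity_liftD[OF U]
  have u [simp]: "U (0, 0) \<in> carrier R" using pos by simp
  have absorb: "f (E i j (c \<otimes> U (0, 0) \<otimes> d)) = f (E i j (c \<otimes> d))"
    if cd: "c \<in> carrier R" "d \<in> carrier R" for c d i j
  proof -
    have "f (E i j (c \<otimes> U (0, 0) \<otimes> d)) = f (E i 0 c \<otimes>\<^bsub>M\<^esub> U \<otimes>\<^bsub>M\<^esub> E 0 j d)"
      using cd pos by (simp add: E_mult_mult_E del: f_simps)
    also have "\<dots> = f (E i 0 c \<otimes>\<^bsub>M\<^esub> E 0 j d)" using cd by simp
    also have "\<dots> = f (E i j (c \<otimes> d))" using cd pos by (simp add: E_mult_E del: f_simps)
    finally show ?thesis .
  qed
  have "f (E i j (c \<otimes> (U (0, 0) \<otimes> a) \<otimes> d)) = f (E i j (c \<otimes> a \<otimes> d))"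
    if "c \<in> carrier R" "d \<in> carrier R" for c d i j
    using absorb[of c "a \<otimes> d" i j] a that by (simp add: m_closed m_assoc)
  then have "f (E 0 0 (U (0, 0) \<otimes> a)) = f (E 0 0 a)"
    by (rule image_unit_cancel[rotated 4]) (use a pos in \<open>simp_all add: m_closed\<close>)
  then show "f (E 0 0 (U (0, 0))) \<otimes>\<^bsub>T\<^esub> f (E 0 0 a) = f (E 0 0 a)" using a by (simp add: corner_map)
  have "f (E i j (c \<otimes> (a \<otimes> U (0, 0)) \<otimes> d)) = f (E i j (c \<otimes> a \<otimes> d))"
    if "c \<in> carrier R" "d \<in> carrier R" for c d i j
    using absorb[of "c \<otimes> a" d i j] a that by (simp add: m_closed m_assoc)
  then have "f (E 0 0 (a \<otimes> U (0, 0))) = f (E 0 0 a)"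
    by (rule image_unit_cancel[rotated 4]) (use a pos in \<open>simp_all add: m_closed\<close>)
  then show "f (E 0 0 a) \<otimes>\<^bsub>T\<^esub> f (E 0 0 (U (0, 0))) = f (E 0 0 a)" using a by (simp add: corner_map)
qed

lemma has_unity_corner: "has_unity corner"
proof -
  obtain U where U: "identity_lift U" using identity_lift_exists by blast
  have "U (0, 0) \<in> carrier R" using identity_liftD(1)[OF U] pos by simp
  then show ?thesis
    unfolding has_unity_def using corner_identity[OF U]
    by (intro bexI[of _ "f (E 0 0 (U (0, 0)))"]) auto
qed

text \<open>
  If all \<open>f (E 0 0 x)\<close> vanish, so does \<open>f\<close> on \<open>E i 0 c \<cdot> E 0 0 a \<cdot> E 0 j d = E i j (c \<cdot> a \<cdot> d)\<close>,
  and hence on every \<open>E k l a\<close>.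
\<close>

lemma corner_nonzero:
  assumes "carrier T \<noteq> {\<zero>\<^bsub>T\<^esub>}"
  shows "carrier corner \<noteq> {\<zero>\<^bsub>corner\<^esub>}"
proof
  assume "carrier corner = {\<zero>\<^bsub>corner\<^esub>}"
  then have zero: "f (E 0 0 a) = \<zero>\<^bsub>T\<^esub>" if "a \<in> carrier R" for a using that by auto
  have unit: "f (E k l a) = f (E k l \<zero>)" if "a \<in> carrier R" "k < n" "l < n" for a k l
  proof (rule image_unit_cancel)
    fix c d i j assume cd: "c \<in> carrier R" "d \<in> carrier R" "i < n" "j < n"
    have "f (E i j (c \<otimes> x \<otimes> d)) = f (E i 0 c) \<otimes>\<^bsub>T\<^esub> \<zero>\<^bsub>T\<^esub> \<otimes>\<^bsub>T\<^esub> f (E 0 j d)" if "x \<in> carrier R" for x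
    proof -
      have "E i j (c \<otimes> x \<otimes> d) = E i 0 c \<otimes>\<^bsub>M\<^esub> E 0 0 x \<otimes>\<^bsub>M\<^esub> E 0 j d"
        using cd that pos by (simp add: E_mult_E m_closed)
      then show ?thesis using cd that by (simp add: zero)
    qed
    from this[of a] this[of \<zero>] show "f (E i j (c \<otimes> a \<otimes> d)) = f (E i j (c \<otimes> \<zero> \<otimes> d))"
      using that by simp
  qed (use that in auto)
  have "f A = f \<zero>\<^bsub>M\<^esub>" if A: "A \<in> carrier M" for A
  proof (rule image_eq_by_entries)
    fix i j assume ij: "i < n" "j < n"
    show "f (E i j (A (i, j))) = f (E i j (\<zero>\<^bsub>M\<^esub> (i, j)))"
      using unit[OF entry_closed[OF A ij] ij] by (simp only: entry(3)[OF ij])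
  qed (use A in simp_all)
  then have "carrier T \<subseteq> {\<zero>\<^bsub>T\<^esub>}" using surj by auto
  then show False using assms T.zero_closed by blast
qed

text \<open>
  An ideal \<open>I\<close> of the corner pulls back to an ideal \<open>J\<close> of \<open>R\<close>, and \<open>f\<close> maps the matrices over
  \<open>J\<close> onto an ideal of \<open>T\<close>.  If this ideal is \<open>T\<close>, then it contains the identity, whose preimage \<open>U\<close> can
  be chosen with entries in \<open>J\<close>; then \<open>I\<close> contains the identity \<open>f (E 0 0 (U 0 0))\<close> of the corner.
\<close>

lemma ideal_simple_corner:
  assumes simple: "ideal_simple T"
  shows "ideal_simple corner"
  unfolding ideal_simple_def
proof (intro allI impI)
  fix I assume I: "hemiring_ideal corner I"
  let ?J = "{a \<in> carrier R. f (E 0 0 a) \<in> I}"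
  let ?K = "{A \<in> carrier M. \<forall>i<n. \<forall>j<n. A (i, j) \<in> ?J}"
  note I_closed = hemiring_idealD[OF I, simplified]
  have zero: "\<zero> \<in> ?J" using I_closed(2) by (simp add: corner_map)
  have add: "a \<oplus> b \<in> ?J" if "a \<in> ?J" "b \<in> ?J" for a b
    using that I_closed(3) by (simp add: corner_map[symmetric])
  have mult: "b \<otimes> a \<in> ?J" "a \<otimes> b \<in> ?J" if "a \<in> ?J" "b \<in> carrier R" for a b
    using that I_closed(4,5) by (simp_all add: corner_map[symmetric] m_closed)
  have sum: "(\<Oplus>k\<in>K. g k) \<in> ?J" if "finite K" "\<forall>k\<in>K. g k \<in> ?J" for K :: "nat set" and g
    using that
  proof (induction K rule: finite_induct)
    case (insert k K)
    then have "(\<Oplus>k\<in>insert k K. g k) = g k \<oplus> (\<Oplus>k\<in>K. g k)" by (intro finsum_insert) auto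
    then show ?case using insert add by simp
  qed (use zero in simp)
  have "hemiring_ideal M ?K"
    unfolding hemiring_ideal_def
  proof (intro conjI ballI)
    fix A B assume "A \<in> ?K" "B \<in> carrier M"
    then show "B \<otimes>\<^bsub>M\<^esub> A \<in> ?K" "A \<otimes>\<^bsub>M\<^esub> B \<in> ?K"
      using sum mult by (auto simp del: mem_Collect_eq simp: mem_Collect_eq[of _ "\<lambda>A. A \<in> carrier M \<and> _ A"])
  qed (use zero add in auto)
  then have "hemiring_ideal T (f ` ?K)" by (rule hemiring_ideal_image[OF hom surj])
  then consider "f ` ?K = {\<zero>\<^bsub>T\<^esub>}" | "f ` ?K = carrier T" using simple by (auto simp: ideal_simple_def)
  then show "I = {\<zero>\<^bsub>corner\<^esub>} \<or> I = carrier corner"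
  proof cases
    case 1
    have "I \<subseteq> {\<zero>\<^bsub>T\<^esub>}"
    proof
      fix x assume x: "x \<in> I"
      obtain a where a: "a \<in> carrier R" "x = f (E 0 0 a)" using subsetD[OF I_closed(1) x] by auto
      then have "E 0 0 a \<in> ?K" using x zero by auto
      then show "x \<in> {\<zero>\<^bsub>T\<^esub>}" using 1 a(2) by blast
    qed
    then show ?thesis using I_closed(2) by auto
  next
    case 2
    obtain V where V: "identity_lift V" using identity_lift_exists by blast
    then have "f V \<in> f ` ?K" using 2 by (simp add: identity_liftD)
    then obtain U where eq: "f V = f U" and U: "U \<in> ?K" by (rule imageE)
    then have lift: "identity_lift U" using V eq by (auto simp: identity_lift_def)
    have "carrier corner \<subseteq> I"
    proof
      fix x assume "x \<in> carrier corner"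
      then obtain a where a: "a \<in> carrier R" "x = f (E 0 0 a)" by auto
      have "f (E 0 0 (U (0, 0))) \<otimes>\<^bsub>T\<^esub> x \<in> I"
        using U pos a I_closed(5) by auto
      then show "x \<in> I" using corner_identity(1)[OF lift a(1)] a(2) by simp
    qed
    then show ?thesis using hemiring_idealD(1)[OF I] by simp
  qed
qed

end

lemma (in matrices_over) matric_brown_mccoy:
  assumes "1 \<le> n"
  shows "R \<in> brown_mccoy_class \<longleftrightarrow> M \<in> brown_mccoy_class"
proof -
  interpret M: plain_hemiring M by (intro plain_hemiring.intro hemiring_matrix)
  have pos: "0 < n" using assms by simp
  have "R \<in> upper_class" if M: "M \<in> upper_class"
  proof -
    have False if S: "hom_image R S" "carrier S \<noteq> {\<zero>\<^bsub>S\<^esub>}" "ideal_simple S" "has_unity S"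
      for S :: "'a set ring"
    proof -
      interpret S: matrices_over S n
        using S(1) by (intro matrices_over.intro plain_hemiring.intro) (simp add: hom_image_def)
      show False
        using upper_class_image[OF M hom_image_matrix[OF hemiring_axioms S(1)] S.matrix_nonzero[OF pos S(2)]
          S.ideal_simple_matrix[OF pos S(4,3)] S.has_unity_matrix[OF S(4)]] .
    qed
    then show ?thesis unfolding upper_class_def using hemiring_axioms by blast
  qed
  moreover have "M \<in> upper_class" if R: "R \<in> upper_class"
  proof -
    have False if T: "hom_image M T" "carrier T \<noteq> {\<zero>\<^bsub>T\<^esub>}" "ideal_simple T" "has_unity T"
      for T :: "(nat \<times> nat \<Rightarrow> 'a) set ring"
    proof -
      obtain f where f: "f \<in> hemiring_hom M T" "f ` carrier M = carrier T"
        using T(1) by (auto simp: hom_image_def)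
      interpret matrix_semiring_image R n T f
        using T(1,4) f pos matrices_over_axioms
        by (intro matrix_semiring_image.intro matrix_semiring_image_axioms.intro)
          (simp_all add: hom_image_def)
      show False
        using upper_class_image[OF R hom_image_corner corner_nonzero[OF T(2)]
          ideal_simple_corner[OF T(3)] has_unity_corner] .
    qed
    then show ?thesis unfolding upper_class_def using hemiring_matrix by blast
  qed
  ultimately show ?thesis by (simp only: brown_mccoy_class_iff M.brown_mccoy_class_iff) blast
qed

section \<open>The radical \<open>J\<^sub>s\<close>\<close>

lemma (in plain_hemiring) J_s_class_iff:
  "R \<in> J_s_class \<longleftrightarrow> \<not> (\<exists>V :: ('a, 'a set) module. simple_semimodule R V)"
proof
  assume R: "R \<in> J_s_class"
  have False if V: "simple_semimodule R V" for V :: "('a, 'a set) module"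
  proof -
    have "carrier R \<subseteq> annihilator R V"
      using R V by (auto simp: J_s_class_def J_s_def)
    then show False using V by (auto simp: simple_semimodule_def annihilator_def)
  qed
  then show "\<not> (\<exists>V :: ('a, 'a set) module. simple_semimodule R V)" by blast
next
  assume "\<not> (\<exists>V :: ('a, 'a set) module. simple_semimodule R V)"
  then have "J_s R = carrier R" by (auto simp: J_s_def)
  then show "R \<in> J_s_class" using hemiring_axioms by (simp add: J_s_class_def)
qed

lemma (in plain_hemiring) J_s_class_no_simple_semimodule:
  fixes V :: "('a, 'b) module"
  assumes "R \<in> J_s_class" and "simple_semimodule R V"
  shows False
proof -
  have "carrier R \<subseteq> annihilator R V"
    using J_s_subset_annihilator[OF assms(2)] assms(1) by (simp add: J_s_class_def)
  then show False using assms(2) by (auto simp: simple_semimodule_def annihilator_def)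
qed

lemma semimodule_congruenceD:
  assumes "semimodule_congruence R V \<rho>"
  shows "(x, y) \<in> \<rho> \<Longrightarrow> x \<in> carrier V" and "(x, y) \<in> \<rho> \<Longrightarrow> y \<in> carrier V"
    and "x \<in> carrier V \<Longrightarrow> (x, x) \<in> \<rho>" and "(x, y) \<in> \<rho> \<Longrightarrow> (y, x) \<in> \<rho>"
    and "\<lbrakk> (x, y) \<in> \<rho>; (y, z) \<in> \<rho> \<rbrakk> \<Longrightarrow> (x, z) \<in> \<rho>"
    and "\<lbrakk> (x, x') \<in> \<rho>; (y, y') \<in> \<rho> \<rbrakk> \<Longrightarrow> (x \<oplus>\<^bsub>V\<^esub> y, x' \<oplus>\<^bsub>V\<^esub> y') \<in> \<rho>"
    and "\<lbrakk> r \<in> carrier R; (x, y) \<in> \<rho> \<rbrakk> \<Longrightarrow> (r \<odot>\<^bsub>V\<^esub> x, r \<odot>\<^bsub>V\<^esub> y) \<in> \<rho>"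
  using assms unfolding semimodule_congruence_def equiv_def refl_on_def sym_def trans_def by blast+

lemma semimodule_congruenceI:
  assumes "\<And>x y. (x, y) \<in> \<rho> \<Longrightarrow> x \<in> carrier V \<and> y \<in> carrier V"
    and "\<And>x. x \<in> carrier V \<Longrightarrow> (x, x) \<in> \<rho>" and "\<And>x y. (x, y) \<in> \<rho> \<Longrightarrow> (y, x) \<in> \<rho>"
    and "\<And>x y z. \<lbrakk> (x, y) \<in> \<rho>; (y, z) \<in> \<rho> \<rbrakk> \<Longrightarrow> (x, z) \<in> \<rho>"
    and "\<And>x x' y y'. \<lbrakk> (x, x') \<in> \<rho>; (y, y') \<in> \<rho> \<rbrakk> \<Longrightarrow> (x \<oplus>\<^bsub>V\<^esub> y, x' \<oplus>\<^bsub>V\<^esub> y') \<in> \<rho>"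
    and "\<And>r x y. \<lbrakk> r \<in> carrier R; (x, y) \<in> \<rho> \<rbrakk> \<Longrightarrow> (r \<odot>\<^bsub>V\<^esub> x, r \<odot>\<^bsub>V\<^esub> y) \<in> \<rho>"
  shows "semimodule_congruence R V \<rho>"
  unfolding semimodule_congruence_def
proof (intro conjI equivI)
  show "\<rho> \<subseteq> carrier V \<times> carrier V" using assms(1) by auto
  show "refl_on (carrier V) \<rho>" using assms(2) by (simp add: refl_on_def)
  show "sym \<rho>" using assms(3) by (rule symI)
  show "trans \<rho>" using assms(4) by (rule transI)
qed (use assms(5,6) in auto)

locale simple_left_semimodule = left_semimodule R V
  for R :: "'a ring" (structure) and V :: "('a, 'b) module" (structure) +
  assumes simple: "simple_semimodule R V"
begin

lemma simple_nontrivial: "\<exists>r\<in>carrier R. \<exists>v\<in>carrier V. r \<odot>\<^bsub>V\<^esub> v \<noteq> \<zero>\<^bsub>V\<^esub>"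
  using simple by (simp add: simple_semimodule_def)

lemma simple_congruence:
  assumes "semimodule_congruence R V \<rho>"
  obtains "\<rho> = Id_on (carrier V)" | "\<rho> = carrier V \<times> carrier V"
  using simple assms unfolding simple_semimodule_def by metis

text \<open>
  Having the same products with all of \<open>R\<close> is a congruence.  It is not the total one because \<open>R\<close>
  does not annihilate \<open>V\<close>.
\<close>

lemma simple_separates:
  assumes v: "v \<in> carrier V" and w: "w \<in> carrier V"
    and eq: "\<And>r. r \<in> carrier R \<Longrightarrow> r \<odot>\<^bsub>V\<^esub> v = r \<odot>\<^bsub>V\<^esub> w"
  shows "v = w"
proof -
  let ?\<tau> = "{(x, y). x \<in> carrier V \<and> y \<in> carrier V \<and> (\<forall>r\<in>carrier R. r \<odot>\<^bsub>V\<^esub> x = r \<odot>\<^bsub>V\<^esub> y)}"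
  have "semimodule_congruence R V ?\<tau>"
    by (rule semimodule_congruenceI)
      (auto simp: smult_closed smult_r_distr smult_assoc[symmetric] R.m_closed)
  then consider "?\<tau> = Id_on (carrier V)" | "?\<tau> = carrier V \<times> carrier V"
    by (rule simple_congruence)
  then show ?thesis
  proof cases
    case 1
    have "(v, w) \<in> ?\<tau>" using assms by blast
    then show ?thesis unfolding 1 by blast
  next
    case 2
    obtain r x where rx: "r \<in> carrier R" "x \<in> carrier V" "r \<odot>\<^bsub>V\<^esub> x \<noteq> \<zero>\<^bsub>V\<^esub>"
      using simple_nontrivial by blast
    then have "(x, \<zero>\<^bsub>V\<^esub>) \<in> ?\<tau>" unfolding 2 by simp
    then have "r \<odot>\<^bsub>V\<^esub> x = r \<odot>\<^bsub>V\<^esub> \<zero>\<^bsub>V\<^esub>" using rx by blast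
    then show ?thesis using rx by (simp add: smult_r_null)
  qed
qed

text \<open>\<open>R v\<close> is a subsemimodule, and nonzero because the action separates \<open>v\<close> from zero.\<close>

lemma simple_generates:
  assumes v: "v \<in> carrier V" "v \<noteq> \<zero>\<^bsub>V\<^esub>" and w: "w \<in> carrier V"
  shows "\<exists>r\<in>carrier R. w = r \<odot>\<^bsub>V\<^esub> v"
proof -
  let ?C = "(\<lambda>r. r \<odot>\<^bsub>V\<^esub> v) ` carrier R"
  have "subsemimodule R V ?C"
    unfolding subsemimodule_def
  proof (intro conjI ballI)
    show "?C \<subseteq> carrier V" using v by (auto simp: smult_closed)
    show "\<zero>\<^bsub>V\<^esub> \<in> ?C" using v smult_l_null[of v] by (metis R.zero_closed image_eqI)
    show "x \<oplus>\<^bsub>V\<^esub> y \<in> ?C" if "x \<in> ?C" "y \<in> ?C" for x y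
      using that v by (auto simp: smult_l_distr[symmetric])
    show "s \<odot>\<^bsub>V\<^esub> x \<in> ?C" if "s \<in> carrier R" "x \<in> ?C" for s x
      using that v by (auto simp: smult_assoc[symmetric] R.m_closed)
  qed
  moreover have "?C \<noteq> {\<zero>\<^bsub>V\<^esub>}"
  proof
    assume *: "?C = {\<zero>\<^bsub>V\<^esub>}"
    have "v = \<zero>\<^bsub>V\<^esub>"
    proof (rule simple_separates)
      fix r assume "r \<in> carrier R"
      then show "r \<odot>\<^bsub>V\<^esub> v = r \<odot>\<^bsub>V\<^esub> \<zero>\<^bsub>V\<^esub>" using * by (auto simp: smult_r_null)
    qed (use v in auto)
    then show False using v by simp
  qed
  ultimately have "?C = carrier V" using simple unfolding simple_semimodule_def by blast
  then show ?thesis using w by blast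
qed

end

context left_semimodule
begin

lemma smult_finsum:
  assumes "finite K" and "f \<in> K \<rightarrow> carrier M" and "r \<in> carrier R"
  shows "r \<odot>\<^bsub>M\<^esub> (\<Oplus>\<^bsub>M\<^esub>k\<in>K. f k) = (\<Oplus>\<^bsub>M\<^esub>k\<in>K. r \<odot>\<^bsub>M\<^esub> f k)"
  using assms by (induction K rule: finite_induct) (simp_all add: smult_r_null smult_r_distr smult_closed Pi_def)

lemma finsum_smult:
  assumes "finite K" and "f \<in> K \<rightarrow> carrier R" and "v \<in> carrier M"
  shows "(\<Oplus>\<^bsub>R\<^esub>k\<in>K. f k) \<odot>\<^bsub>M\<^esub> v = (\<Oplus>\<^bsub>M\<^esub>k\<in>K. f k \<odot>\<^bsub>M\<^esub> v)"
  using assms by (induction K rule: finite_induct) (simp_all add: smult_l_null smult_l_distr smult_closed Pi_def)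

end

text \<open>
  Columns of length \<open>n\<close>, with matrices acting by the matrix-vector product.  The module record
  contains a multiplication and an identity, which a semimodule does not have; hence \<open>undefined\<close>.
\<close>

definition column_module :: "nat \<Rightarrow> ('a, 'b) module \<Rightarrow> (nat \<times> nat \<Rightarrow> 'a, nat \<Rightarrow> 'b) module" where
  "column_module n V =
     \<lparr> carrier = {..<n} \<rightarrow>\<^sub>E carrier V, mult = undefined, one = undefined,
       zero = (\<lambda>i\<in>{..<n}. \<zero>\<^bsub>V\<^esub>),
       add = (\<lambda>x y. \<lambda>i\<in>{..<n}. x i \<oplus>\<^bsub>V\<^esub> y i),
       smult = (\<lambda>A x. \<lambda>i\<in>{..<n}. \<Oplus>\<^bsub>V\<^esub>k\<in>{..<n}. A (i, k) \<odot>\<^bsub>V\<^esub> x k) \<rparr>"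

locale columns_over = matrices_over R n + V: simple_left_semimodule R V
  for R :: "'a ring" (structure) and n and V :: "('a, 'b) module"
begin

abbreviation "C \<equiv> column_module n V"

definition col :: "nat \<Rightarrow> 'b \<Rightarrow> nat \<Rightarrow> 'b" where
  "col i v = (\<lambda>k\<in>{..<n}. if k = i then v else \<zero>\<^bsub>V\<^esub>)"

lemma column_closed_iff: "x \<in> carrier C \<longleftrightarrow> x \<in> {..<n} \<rightarrow>\<^sub>E carrier V"
  by (simp add: column_module_def)

lemma column_entry_closed [simp, intro]: "x \<in> carrier C \<Longrightarrow> i < n \<Longrightarrow> x i \<in> carrier V"
  by (auto simp: column_closed_iff)

lemma column_eqI:
  assumes "x \<in> carrier C" and "y \<in> carrier C" and "\<And>i. i < n \<Longrightarrow> x i = y i"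
  shows "x = y"
  by (rule PiE_ext[where k = "{..<n}"]) (use assms in \<open>auto simp: column_closed_iff\<close>)

lemma column_entry [simp]:
  assumes "i < n"
  shows "(x \<oplus>\<^bsub>C\<^esub> y) i = x i \<oplus>\<^bsub>V\<^esub> y i"
    and "(A \<odot>\<^bsub>C\<^esub> x) i = (\<Oplus>\<^bsub>V\<^esub>k\<in>{..<n}. A (i, k) \<odot>\<^bsub>V\<^esub> x k)"
    and "\<zero>\<^bsub>C\<^esub> i = \<zero>\<^bsub>V\<^esub>"
    and "col j v i = (if i = j then v else \<zero>\<^bsub>V\<^esub>)"
  using assms by (simp_all add: column_module_def col_def)

lemma column_closed [simp, intro]:
  "x \<in> carrier C \<Longrightarrow> y \<in> carrier C \<Longrightarrow> x \<oplus>\<^bsub>C\<^esub> y \<in> carrier C"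
  "A \<in> carrier M \<Longrightarrow> x \<in> carrier C \<Longrightarrow> A \<odot>\<^bsub>C\<^esub> x \<in> carrier C"
  "\<zero>\<^bsub>C\<^esub> \<in> carrier C"
  "v \<in> carrier V \<Longrightarrow> col i v \<in> carrier C"
proof -
  have *: "(\<lambda>i\<in>{..<n}. f i) \<in> carrier C" if "\<And>i. i < n \<Longrightarrow> f i \<in> carrier V" for f
    using that by (auto simp: column_closed_iff)
  show "\<zero>\<^bsub>C\<^esub> \<in> carrier C" using *[of "\<lambda>_. \<zero>\<^bsub>V\<^esub>"] by (simp add: column_module_def)
  show "col i v \<in> carrier C" if "v \<in> carrier V" using that unfolding col_def by (intro *) auto
  assume x: "x \<in> carrier C"
  show "A \<odot>\<^bsub>C\<^esub> x \<in> carrier C" if A: "A \<in> carrier M"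
  proof -
    have "A \<odot>\<^bsub>C\<^esub> x = (\<lambda>i\<in>{..<n}. (A \<odot>\<^bsub>C\<^esub> x) i)" by (auto simp: column_module_def fun_eq_iff)
    moreover have "(\<lambda>i\<in>{..<n}. (A \<odot>\<^bsub>C\<^esub> x) i) \<in> carrier C"
      using A x by (intro *) (simp add: Pi_def V.smult_closed)
    ultimately show ?thesis by simp
  qed
  show "x \<oplus>\<^bsub>C\<^esub> y \<in> carrier C" if y: "y \<in> carrier C"
  proof -
    have "x \<oplus>\<^bsub>C\<^esub> y = (\<lambda>i\<in>{..<n}. (x \<oplus>\<^bsub>C\<^esub> y) i)" by (auto simp: column_module_def fun_eq_iff)
    moreover have "(\<lambda>i\<in>{..<n}. (x \<oplus>\<^bsub>C\<^esub> y) i) \<in> carrier C" using x y by (intro *) simp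
    ultimately show ?thesis by simp
  qed
qed

lemma column_smult_assoc:
  assumes A: "A \<in> carrier M" and B: "B \<in> carrier M" and x: "x \<in> carrier C"
  shows "(A \<otimes>\<^bsub>M\<^esub> B) \<odot>\<^bsub>C\<^esub> x = A \<odot>\<^bsub>C\<^esub> (B \<odot>\<^bsub>C\<^esub> x)"
proof (rule column_eqI)
  fix i assume i: "i < n"
  have "((A \<otimes>\<^bsub>M\<^esub> B) \<odot>\<^bsub>C\<^esub> x) i = (\<Oplus>\<^bsub>V\<^esub>l\<in>{..<n}. (\<Oplus>k\<in>{..<n}. A (i, k) \<otimes> B (k, l)) \<odot>\<^bsub>V\<^esub> x l)"
    unfolding column_entry(2)[OF i]
    using i A B x by (intro V.M.finsum_cong') (simp_all add: Pi_def m_closed V.smult_closed)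
  also have "\<dots> = (\<Oplus>\<^bsub>V\<^esub>l\<in>{..<n}. \<Oplus>\<^bsub>V\<^esub>k\<in>{..<n}. (A (i, k) \<otimes> B (k, l)) \<odot>\<^bsub>V\<^esub> x l)"
    using i A B x
    by (intro V.M.finsum_cong' V.finsum_smult) (simp_all add: Pi_def m_closed V.smult_closed)
  also have "\<dots> = (\<Oplus>\<^bsub>V\<^esub>k\<in>{..<n}. \<Oplus>\<^bsub>V\<^esub>l\<in>{..<n}. (A (i, k) \<otimes> B (k, l)) \<odot>\<^bsub>V\<^esub> x l)"
    using i A B x by (intro V.M.finsum_commute) (simp_all add: m_closed V.smult_closed)
  also have "\<dots> = (\<Oplus>\<^bsub>V\<^esub>k\<in>{..<n}. A (i, k) \<odot>\<^bsub>V\<^esub> (\<Oplus>\<^bsub>V\<^esub>l\<in>{..<n}. B (k, l) \<odot>\<^bsub>V\<^esub> x l))"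
  proof (intro V.M.finsum_cong' Pi_I)
    fix k assume "k \<in> {..<n}"
    then have k: "k < n" by simp
    have "(\<Oplus>\<^bsub>V\<^esub>l\<in>{..<n}. (A (i, k) \<otimes> B (k, l)) \<odot>\<^bsub>V\<^esub> x l) =
        (\<Oplus>\<^bsub>V\<^esub>l\<in>{..<n}. A (i, k) \<odot>\<^bsub>V\<^esub> (B (k, l) \<odot>\<^bsub>V\<^esub> x l))"
      using i k A B x by (intro V.M.finsum_cong') (simp_all add: Pi_def V.smult_closed V.smult_assoc)
    then show "(\<Oplus>\<^bsub>V\<^esub>l\<in>{..<n}. (A (i, k) \<otimes> B (k, l)) \<odot>\<^bsub>V\<^esub> x l) =
        A (i, k) \<odot>\<^bsub>V\<^esub> (\<Oplus>\<^bsub>V\<^esub>l\<in>{..<n}. B (k, l) \<odot>\<^bsub>V\<^esub> x l)"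
      using i k A B x by (simp add: Pi_def V.smult_closed V.smult_finsum)
  qed (use i A B x in \<open>simp_all add: Pi_def V.smult_closed\<close>)
  also have "\<dots> = (A \<odot>\<^bsub>C\<^esub> (B \<odot>\<^bsub>C\<^esub> x)) i"
    unfolding column_entry(2)[OF i]
    using i A B x by (intro V.M.finsum_cong') (simp_all add: Pi_def V.smult_closed)
  finally show "((A \<otimes>\<^bsub>M\<^esub> B) \<odot>\<^bsub>C\<^esub> x) i = (A \<odot>\<^bsub>C\<^esub> (B \<odot>\<^bsub>C\<^esub> x)) i" .
qed (use A B x in auto)

lemma left_semimodule_column: "left_semimodule M C"
proof (intro left_semimodule.intro left_semimodule_axioms.intro)
  show "hemiring M" by (rule hemiring_matrix)
  show "abelian_monoid C"
    unfolding abelian_monoid_iff by (auto intro!: column_eqI simp: V.M.a_ac)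
next
  fix A x assume A: "A \<in> carrier M" and x: "x \<in> carrier C"
  show "A \<odot>\<^bsub>C\<^esub> x \<in> carrier C" using A x by simp
  show "A \<odot>\<^bsub>C\<^esub> (x \<oplus>\<^bsub>C\<^esub> y) = A \<odot>\<^bsub>C\<^esub> x \<oplus>\<^bsub>C\<^esub> A \<odot>\<^bsub>C\<^esub> y" if y: "y \<in> carrier C" for y
  proof (rule column_eqI)
    fix i assume i: "i < n"
    have "(\<Oplus>\<^bsub>V\<^esub>k\<in>{..<n}. A (i, k) \<odot>\<^bsub>V\<^esub> (x \<oplus>\<^bsub>C\<^esub> y) k) =
        (\<Oplus>\<^bsub>V\<^esub>k\<in>{..<n}. A (i, k) \<odot>\<^bsub>V\<^esub> x k \<oplus>\<^bsub>V\<^esub> A (i, k) \<odot>\<^bsub>V\<^esub> y k)"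
      using A x y i by (intro V.M.finsum_cong') (simp_all add: Pi_def V.smult_closed V.smult_r_distr)
    then show "(A \<odot>\<^bsub>C\<^esub> (x \<oplus>\<^bsub>C\<^esub> y)) i = (A \<odot>\<^bsub>C\<^esub> x \<oplus>\<^bsub>C\<^esub> A \<odot>\<^bsub>C\<^esub> y) i"
      using A x y i by (simp add: Pi_def V.smult_closed)
  qed (use A x y in auto)
  show "(A \<oplus>\<^bsub>M\<^esub> B) \<odot>\<^bsub>C\<^esub> x = A \<odot>\<^bsub>C\<^esub> x \<oplus>\<^bsub>C\<^esub> B \<odot>\<^bsub>C\<^esub> x" if B: "B \<in> carrier M" for B
  proof (rule column_eqI)
    fix i assume i: "i < n"
    have "(\<Oplus>\<^bsub>V\<^esub>k\<in>{..<n}. (A \<oplus>\<^bsub>M\<^esub> B) (i, k) \<odot>\<^bsub>V\<^esub> x k) =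
        (\<Oplus>\<^bsub>V\<^esub>k\<in>{..<n}. A (i, k) \<odot>\<^bsub>V\<^esub> x k \<oplus>\<^bsub>V\<^esub> B (i, k) \<odot>\<^bsub>V\<^esub> x k)"
      using A x B i by (intro V.M.finsum_cong') (simp_all add: Pi_def V.smult_closed V.smult_l_distr)
    then show "((A \<oplus>\<^bsub>M\<^esub> B) \<odot>\<^bsub>C\<^esub> x) i = (A \<odot>\<^bsub>C\<^esub> x \<oplus>\<^bsub>C\<^esub> B \<odot>\<^bsub>C\<^esub> x) i"
      using A x B i by (simp add: Pi_def V.smult_closed)
  qed (use A x B in auto)
next
  fix A assume A: "A \<in> carrier M"
  have "(\<Oplus>\<^bsub>V\<^esub>k\<in>{..<n}. A (i, k) \<odot>\<^bsub>V\<^esub> \<zero>\<^bsub>C\<^esub> k) = \<zero>\<^bsub>V\<^esub>" if "i < n" for i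
    using A that by (intro V.M.add.finprod_one_eqI) (simp add: V.smult_r_null)
  then show "A \<odot>\<^bsub>C\<^esub> \<zero>\<^bsub>C\<^esub> = \<zero>\<^bsub>C\<^esub>"
    using A by (intro column_eqI) simp_all
next
  fix x assume x: "x \<in> carrier C"
  have "(\<Oplus>\<^bsub>V\<^esub>k\<in>{..<n}. \<zero>\<^bsub>M\<^esub> (i, k) \<odot>\<^bsub>V\<^esub> x k) = \<zero>\<^bsub>V\<^esub>" if "i < n" for i
    using x that by (intro V.M.add.finprod_one_eqI) (simp add: V.smult_l_null)
  then show "\<zero>\<^bsub>M\<^esub> \<odot>\<^bsub>C\<^esub> x = \<zero>\<^bsub>C\<^esub>"
    using x by (intro column_eqI) simp_all
qed (rule column_smult_assoc)

lemma E_smult: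
  assumes "r \<in> carrier R" and "x \<in> carrier C" and "j < n"
  shows "E i j r \<odot>\<^bsub>C\<^esub> x = col i (r \<odot>\<^bsub>V\<^esub> x j)"
proof (rule column_eqI)
  fix p assume p: "p < n"
  have "(\<Oplus>\<^bsub>V\<^esub>k\<in>{..<n}. E i j r (p, k) \<odot>\<^bsub>V\<^esub> x k) = (if p = i then r \<odot>\<^bsub>V\<^esub> x j else \<zero>\<^bsub>V\<^esub>)"
    using assms p by (intro V.M.finsum_delta[of _ j]) (simp_all add: V.smult_closed V.smult_l_null)
  then show "(E i j r \<odot>\<^bsub>C\<^esub> x) p = col i (r \<odot>\<^bsub>V\<^esub> x j) p" using p by simp
qed (use assms in \<open>auto simp: V.smult_closed\<close>)

lemma column_relation_induct:
  assumes x: "x \<in> carrier C" and y: "y \<in> carrier C" and zero: "rel \<zero>\<^bsub>C\<^esub> \<zero>\<^bsub>C\<^esub>"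
    and add: "\<And>u v u' v'. \<lbrakk> u \<in> carrier C; v \<in> carrier C; u' \<in> carrier C; v' \<in> carrier C;
      rel u v; rel u' v' \<rbrakk> \<Longrightarrow> rel (u \<oplus>\<^bsub>C\<^esub> u') (v \<oplus>\<^bsub>C\<^esub> v')"
    and unit: "\<And>i. i < n \<Longrightarrow> rel (col i (x i)) (col i (y i))"
  shows "rel x y"
proof -
  let ?top = "\<lambda>m z. \<lambda>k\<in>{..<n}. if k < m then z k else \<zero>\<^bsub>V\<^esub>"
  have top: "?top m z \<in> carrier C" if "z \<in> carrier C" for m z
    using that by (auto simp: column_closed_iff)
  have "rel (?top m x) (?top m y)" if "m \<le> n" for m
    using that
  proof (induction m)
    case 0
    have "?top 0 z = \<zero>\<^bsub>C\<^esub>" for z by (simp add: column_module_def)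
    then show ?case using zero by simp
  next
    case (Suc m)
    have "?top (Suc m) z = ?top m z \<oplus>\<^bsub>C\<^esub> col m (z m)" if z: "z \<in> carrier C" for z
      using z Suc.prems by (intro column_eqI top column_closed) auto
    then show ?case using Suc x y by (simp add: add unit top del: restrict_apply)
  qed
  from this[of n] moreover have "?top n z = z" if "z \<in> carrier C" for z
    using that by (intro column_eqI top) auto
  ultimately show ?thesis using x y by simp
qed

text \<open>
  A column \<open>x\<close> with \<open>x j \<noteq> \<zero>\<close> generates everything: \<open>E i j r\<close> sends it to the column with \<open>r \<cdot> x j\<close>
  at \<open>i\<close>, and \<open>r \<cdot> x j\<close> runs over \<open>V\<close>.  A congruence \<open>\<rho>\<close> on columns induces the congruence
  \<open>\<sigma>\<close> on \<open>V\<close> that relates \<open>v\<close> and \<open>w\<close> when \<open>\<rho>\<close> relates the columns with \<open>v\<close> and \<open>w\<close> in any one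
  position; \<open>\<sigma>\<close> is total if \<open>\<rho>\<close> relates two different columns.
\<close>

lemma simple_column_module:
  assumes n: "0 < n"
  shows "simple_semimodule M C"
  unfolding simple_semimodule_def
proof (intro conjI allI impI)
  show "left_semimodule M C" by (rule left_semimodule_column)
next
  obtain r v where rv: "r \<in> carrier R" "v \<in> carrier V" "r \<odot>\<^bsub>V\<^esub> v \<noteq> \<zero>\<^bsub>V\<^esub>"
    using V.simple_nontrivial by blast
  have "(E 0 0 r \<odot>\<^bsub>C\<^esub> col 0 v) 0 \<noteq> \<zero>\<^bsub>C\<^esub> 0"
    using rv n by (simp add: E_smult del: column_entry(2))
  then have "E 0 0 r \<odot>\<^bsub>C\<^esub> col 0 v \<noteq> \<zero>\<^bsub>C\<^esub>" by metis
  then show "\<exists>A\<in>carrier M. \<exists>x\<in>carrier C. A \<odot>\<^bsub>C\<^esub> x \<noteq> \<zero>\<^bsub>C\<^esub>" using rv by blast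
next
  fix N assume N: "subsemimodule M C N"
  have N_simps: "\<zero>\<^bsub>C\<^esub> \<in> N" "N \<subseteq> carrier C" "\<And>x y. x \<in> N \<Longrightarrow> y \<in> N \<Longrightarrow> x \<oplus>\<^bsub>C\<^esub> y \<in> N"
      "\<And>A x. A \<in> carrier M \<Longrightarrow> x \<in> N \<Longrightarrow> A \<odot>\<^bsub>C\<^esub> x \<in> N"
    using N by (auto simp: subsemimodule_def)
  show "N = {\<zero>\<^bsub>C\<^esub>} \<or> N = carrier C"
  proof (cases "N = {\<zero>\<^bsub>C\<^esub>}")
    case False
    then obtain x where x: "x \<in> N" "x \<noteq> \<zero>\<^bsub>C\<^esub>" using N_simps(1) by blast
    have xc: "x \<in> carrier C" using x N_simps(2) by blast
    obtain j where j: "j < n" "x j \<noteq> \<zero>\<^bsub>V\<^esub>"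
      using x(2) column_eqI[OF xc, of "\<zero>\<^bsub>C\<^esub>"] by auto
    have "y \<in> N" if y: "y \<in> carrier C" for y
    proof (rule column_relation_induct[where rel = "\<lambda>u v. u \<in> N" and y = y])
      fix i assume i: "i < n"
      obtain r where r: "r \<in> carrier R" "y i = r \<odot>\<^bsub>V\<^esub> x j"
        using V.simple_generates[of "x j" "y i"] xc y i j by auto
      have "E i j r \<odot>\<^bsub>C\<^esub> x \<in> N" using r x by (intro N_simps) auto
      then show "col i (y i) \<in> N" using r xc j by (simp add: E_smult)
    qed (use y N_simps in \<open>simp_all\<close>)
    then show ?thesis using N_simps(2) by blast
  qed simp
next
  fix \<rho> assume \<rho>: "semimodule_congruence M C \<rho>"
  note \<rho>D = semimodule_congruenceD[OF \<rho>]
  show "\<rho> = Id_on (carrier C) \<or> \<rho> = carrier C \<times> carrier C"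
  proof (cases "\<rho> \<subseteq> Id_on (carrier C)")
    case True
    then have "\<rho> = Id_on (carrier C)" using \<rho>D(3) by blast
    then show ?thesis ..
  next
    case False
    then obtain x y where xy: "(x, y) \<in> \<rho>" "x \<noteq> y" using \<rho>D(1) by fastforce
    have c: "x \<in> carrier C" "y \<in> carrier C" using xy \<rho>D(1,2) by blast+
    obtain j where j: "j < n" "x j \<noteq> y j" using xy(2) column_eqI[OF c] by blast
    let ?\<sigma> = "{(v, w). v \<in> carrier V \<and> w \<in> carrier V \<and> (\<forall>i<n. (col i v, col i w) \<in> \<rho>)}"
    have "semimodule_congruence R V ?\<sigma>"
    proof (rule semimodule_congruenceI)
      fix v v' w w' assume vw: "(v, v') \<in> ?\<sigma>" "(w, w') \<in> ?\<sigma>"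
      have "(col i (v \<oplus>\<^bsub>V\<^esub> w), col i (v' \<oplus>\<^bsub>V\<^esub> w')) \<in> \<rho>" if "i < n" for i
      proof -
        have "col i (a \<oplus>\<^bsub>V\<^esub> b) = col i a \<oplus>\<^bsub>C\<^esub> col i b" if "a \<in> carrier V" "b \<in> carrier V" for a b
          using that by (intro column_eqI) auto
        then show ?thesis using vw \<rho>D(6) that by simp
      qed
      then show "(v \<oplus>\<^bsub>V\<^esub> w, v' \<oplus>\<^bsub>V\<^esub> w') \<in> ?\<sigma>" using vw by simp
    next
      fix r v w assume r: "r \<in> carrier R" and vw: "(v, w) \<in> ?\<sigma>"
      have "(col i (r \<odot>\<^bsub>V\<^esub> v), col i (r \<odot>\<^bsub>V\<^esub> w)) \<in> \<rho>" if i: "i < n" for i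
      proof -
        have "(E i i r \<odot>\<^bsub>C\<^esub> col i v, E i i r \<odot>\<^bsub>C\<^esub> col i w) \<in> \<rho>"
          using vw i r by (intro \<rho>D(7)) auto
        then show ?thesis using vw i r by (simp add: E_smult)
      qed
      then show "(r \<odot>\<^bsub>V\<^esub> v, r \<odot>\<^bsub>V\<^esub> w) \<in> ?\<sigma>" using vw r by (simp add: V.smult_closed)
    next
      fix u v w assume "(u, v) \<in> ?\<sigma>" "(v, w) \<in> ?\<sigma>"
      then show "(u, w) \<in> ?\<sigma>" using \<rho>D(5) by blast
    qed (use \<rho>D(3,4) in auto)
    then consider "?\<sigma> = Id_on (carrier V)" | "?\<sigma> = carrier V \<times> carrier V"
      by (rule V.simple_congruence)
    then show ?thesis
    proof cases
      case 1
      have agree: "r \<odot>\<^bsub>V\<^esub> x j = r \<odot>\<^bsub>V\<^esub> y j" if r: "r \<in> carrier R" for r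
      proof -
        have "(col i (r \<odot>\<^bsub>V\<^esub> x j), col i (r \<odot>\<^bsub>V\<^esub> y j)) \<in> \<rho>" for i
          using \<rho>D(7)[OF _ xy(1), of "E i j r"] r j c by (simp add: E_smult)
        then have "(r \<odot>\<^bsub>V\<^esub> x j, r \<odot>\<^bsub>V\<^esub> y j) \<in> ?\<sigma>" using r j c by (simp add: V.smult_closed)
        then show ?thesis unfolding 1 by (simp add: Id_on_iff)
      qed
      have "x j = y j" by (rule V.simple_separates[OF _ _ agree]) (use c j in auto)
      then show ?thesis using j by simp
    next
      case 2
      have all: "(u, v) \<in> \<rho>" if u: "u \<in> carrier C" and v: "v \<in> carrier C" for u v
      proof (rule column_relation_induct[where rel = "\<lambda>u v. (u, v) \<in> \<rho>"])
        fix i assume i: "i < n"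
        have "(u i, v i) \<in> ?\<sigma>" unfolding 2 using u v i by simp
        then show "(col i (u i), col i (v i)) \<in> \<rho>" using i by blast
      qed (use u v \<rho>D(3,6) in simp_all)
      have "\<rho> = carrier C \<times> carrier C" by (auto intro: all dest: \<rho>D(1,2))
      then show ?thesis ..
    qed
  qed
qed

end

locale matrix_semimodule = matrices_over R n + N: simple_left_semimodule "matrix_hemiring n R" N
  for R :: "'a ring" (structure) and n and N :: "(nat \<times> nat \<Rightarrow> 'a, 'b) module"
begin

text \<open>
  The counterpart for semimodules of the corner of a semiring: \<open>r\<close> acts as \<open>E 0 0 r\<close> on the elements
  reached by matrices with a single nonzero entry in row \<open>0\<close>.  That these elements are closed under
  addition is a consequence of the simplicity of \<open>N\<close>, see \<open>corner_module_generated\<close>.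
\<close>

definition corner_module :: "('a, 'b) module" where
  "corner_module =
     \<lparr> carrier = {E 0 j b \<odot>\<^bsub>N\<^esub> x | j b x. j < n \<and> b \<in> carrier R \<and> x \<in> carrier N},
       mult = undefined, one = undefined, zero = \<zero>\<^bsub>N\<^esub>, add = add N,
       smult = (\<lambda>r x. E 0 0 r \<odot>\<^bsub>N\<^esub> x) \<rparr>"

abbreviation "V \<equiv> corner_module"

lemma corner_module_simps [simp]:
  "\<zero>\<^bsub>V\<^esub> = \<zero>\<^bsub>N\<^esub>" "x \<oplus>\<^bsub>V\<^esub> y = x \<oplus>\<^bsub>N\<^esub> y" "r \<odot>\<^bsub>V\<^esub> x = E 0 0 r \<odot>\<^bsub>N\<^esub> x"
  by (simp_all add: corner_module_def)

lemma corner_module_carrier: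
  "w \<in> carrier V \<longleftrightarrow> (\<exists>j b x. j < n \<and> b \<in> carrier R \<and> x \<in> carrier N \<and> w = E 0 j b \<odot>\<^bsub>N\<^esub> x)"
  by (auto simp: corner_module_def)

lemma corner_memI: "\<lbrakk> j < n; b \<in> carrier R; x \<in> carrier N \<rbrakk> \<Longrightarrow> E 0 j b \<odot>\<^bsub>N\<^esub> x \<in> carrier V"
  by (auto simp: corner_module_carrier)

lemma corner_sub: "w \<in> carrier V \<Longrightarrow> w \<in> carrier N"
  by (auto simp: corner_module_carrier N.smult_closed)

lemma E_smult_E_smult:
  assumes "a \<in> carrier R" and "b \<in> carrier R" and "j < n" and "x \<in> carrier N"
  shows "E i j a \<odot>\<^bsub>N\<^esub> (E k l b \<odot>\<^bsub>N\<^esub> x) = (if j = k then E i l (a \<otimes> b) \<odot>\<^bsub>N\<^esub> x else \<zero>\<^bsub>N\<^esub>)"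
  using assms N.smult_assoc[of "E i j a" "E k l b" x] by (auto simp: E_mult_E N.smult_l_null)

text \<open>
  A nonzero product \<open>E i j a \<cdot> E j l b\<close> equals \<open>E i 0 a \<cdot> E 0 l b\<close>.  So if all \<open>E 0 l b\<close> acted as
  zero, then so would every product of two matrices, and the separation of elements by the action,
  applied twice, would leave only zero in \<open>N\<close>.
\<close>

lemma corner_module_nonzero:
  assumes n: "0 < n"
  shows "\<exists>w\<in>carrier V. w \<noteq> \<zero>\<^bsub>N\<^esub>"
proof (rule ccontr)
  assume "\<not> ?thesis"
  then have zero: "E 0 j b \<odot>\<^bsub>N\<^esub> x = \<zero>\<^bsub>N\<^esub>" if "j < n" "b \<in> carrier R" "x \<in> carrier N" for j b x
    using that corner_memI by blast
  have units: "E i j a \<odot>\<^bsub>N\<^esub> (E k l b \<odot>\<^bsub>N\<^esub> x) = \<zero>\<^bsub>N\<^esub>"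
    if "a \<in> carrier R" "b \<in> carrier R" "x \<in> carrier N" "j < n" "l < n" for i j k l a b x
  proof (cases "j = k")
    case True
    then have "E i j a \<odot>\<^bsub>N\<^esub> (E k l b \<odot>\<^bsub>N\<^esub> x) = E i 0 a \<odot>\<^bsub>N\<^esub> (E 0 l b \<odot>\<^bsub>N\<^esub> x)"
      using that n by (simp add: E_smult_E_smult)
    then show ?thesis using that by (simp add: zero N.smult_r_null)
  qed (use that in \<open>simp add: E_smult_E_smult\<close>)
  have left: "A \<odot>\<^bsub>N\<^esub> (E k l b \<odot>\<^bsub>N\<^esub> x) = \<zero>\<^bsub>N\<^esub>"
    if "A \<in> carrier M" "b \<in> carrier R" "x \<in> carrier N" "l < n" for A k l b x
    by (rule matrix_relation_induct[where rel = "\<lambda>X Y. X \<odot>\<^bsub>N\<^esub> (E k l b \<odot>\<^bsub>N\<^esub> x) = \<zero>\<^bsub>N\<^esub>" and B = A])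
      (use that in \<open>simp_all add: units N.smult_l_null N.smult_l_distr N.smult_closed\<close>)
  have both: "A \<odot>\<^bsub>N\<^esub> (B \<odot>\<^bsub>N\<^esub> x) = \<zero>\<^bsub>N\<^esub>"
    if "A \<in> carrier M" "B \<in> carrier M" "x \<in> carrier N" for A B x
    by (rule matrix_relation_induct[where rel = "\<lambda>X Y. A \<odot>\<^bsub>N\<^esub> (X \<odot>\<^bsub>N\<^esub> x) = \<zero>\<^bsub>N\<^esub>" and B = B])
      (use that in \<open>simp_all add: left N.smult_l_null N.smult_r_null N.smult_l_distr N.smult_r_distr N.smult_closed\<close>)
  have "B \<odot>\<^bsub>N\<^esub> x = \<zero>\<^bsub>N\<^esub>" if "B \<in> carrier M" "x \<in> carrier N" for B x
    by (rule N.simple_separates) (use that in \<open>simp_all add: both N.smult_closed N.smult_r_null\<close>)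
  then show False using N.simple_nontrivial by blast
qed

text \<open>
  For \<open>w = E 0 j b \<cdot> x\<close> and \<open>u = E 0 k a \<cdot> z\<close> write \<open>z = B \<cdot> w\<close>, by simplicity of \<open>N\<close>.  In
  \<open>E 0 k a \<cdot> B \<cdot> E 0 j b\<close> only the entry \<open>B k 0\<close> survives, so \<open>u = E 0 0 (a \<cdot> B k 0) \<cdot> w\<close>.
\<close>

lemma corner_module_generated:
  assumes w: "w \<in> carrier V" "w \<noteq> \<zero>\<^bsub>N\<^esub>" and n: "0 < n" and u: "u \<in> carrier V"
  shows "\<exists>c\<in>carrier R. u = E 0 0 c \<odot>\<^bsub>N\<^esub> w"
proof -
  obtain j b x where x: "j < n" "b \<in> carrier R" "x \<in> carrier N" "w = E 0 j b \<odot>\<^bsub>N\<^esub> x"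
    using w(1) by (auto simp: corner_module_carrier)
  obtain k a z where z: "k < n" "a \<in> carrier R" "z \<in> carrier N" "u = E 0 k a \<odot>\<^bsub>N\<^esub> z"
    using u by (auto simp: corner_module_carrier)
  obtain B where B: "B \<in> carrier M" "z = B \<odot>\<^bsub>N\<^esub> w"
    using N.simple_generates[OF corner_sub[OF w(1)] w(2) z(3)] by blast
  have "u = (E 0 k a \<otimes>\<^bsub>M\<^esub> B \<otimes>\<^bsub>M\<^esub> E 0 j b) \<odot>\<^bsub>N\<^esub> x"
    using B x z by (simp add: N.smult_assoc N.smult_closed)
  also have "\<dots> = E 0 j (a \<otimes> B (k, 0) \<otimes> b) \<odot>\<^bsub>N\<^esub> x"
    using B x z n by (simp add: E_mult_mult_E)
  also have "\<dots> = E 0 0 (a \<otimes> B (k, 0)) \<odot>\<^bsub>N\<^esub> w"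
    using B x z n by (simp add: E_smult_E_smult m_closed)
  finally show ?thesis using B z n m_closed by blast
qed

lemma left_semimodule_corner:
  assumes n: "0 < n"
  shows "left_semimodule R V"
proof -
  have zero: "\<zero>\<^bsub>N\<^esub> \<in> carrier V"
    using corner_memI[of 0 \<zero> "\<zero>\<^bsub>N\<^esub>"] n by (simp add: N.smult_r_null)
  have smult: "E 0 0 r \<odot>\<^bsub>N\<^esub> w \<in> carrier V" if "r \<in> carrier R" "w \<in> carrier V" for r w
    using that n by (intro corner_memI corner_sub)
  obtain w where w: "w \<in> carrier V" "w \<noteq> \<zero>\<^bsub>N\<^esub>" using corner_module_nonzero[OF n] by blast
  have add: "u \<oplus>\<^bsub>N\<^esub> v \<in> carrier V" if uv: "u \<in> carrier V" "v \<in> carrier V" for u v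
  proof -
    obtain c d where "c \<in> carrier R" "d \<in> carrier R" "u = E 0 0 c \<odot>\<^bsub>N\<^esub> w" "v = E 0 0 d \<odot>\<^bsub>N\<^esub> w"
      using corner_module_generated[OF w n] uv by blast
    then have "u \<oplus>\<^bsub>N\<^esub> v = E 0 0 (c \<oplus> d) \<odot>\<^bsub>N\<^esub> w"
      using corner_sub[OF w(1)] by (simp add: E_add N.smult_l_distr)
    then show ?thesis using smult w \<open>c \<in> carrier R\<close> \<open>d \<in> carrier R\<close> by simp
  qed
  show ?thesis
  proof (intro left_semimodule.intro left_semimodule_axioms.intro)
    show "hemiring R" by (rule hemiring_axioms)
    show "abelian_monoid V"
      unfolding abelian_monoid_iff using zero add by (simp add: corner_sub N.M.a_ac)
  qed (use n in \<open>simp_all add: smult corner_sub E_smult_E_smult E_add E_zero N.smult_l_distr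
      N.smult_r_distr N.smult_r_null N.smult_l_null\<close>)
qed

text \<open>
  A congruence \<open>\<rho>\<close> on the corner is extended to the congruence \<open>\<sigma>\<close> on \<open>N\<close> that relates \<open>z\<close> and
  \<open>w\<close> when \<open>\<rho>\<close> relates their images under every \<open>E 0 k a\<close>.  If \<open>\<sigma>\<close> is total, \<open>\<rho>\<close> relates every
  \<open>E 0 j b \<cdot> x\<close> to \<open>E 0 j b \<cdot> \<zero>\<close>.  If \<open>\<sigma>\<close> is the diagonal, so is \<open>\<rho>\<close>, because \<open>E 0 k a\<close>
  annihilates the corner for \<open>k \<noteq> 0\<close> and acts as \<open>a\<close> on it for \<open>k = 0\<close>.
\<close>

lemma simple_corner_module:
  assumes n: "0 < n"
  shows "simple_semimodule R V"
  unfolding simple_semimodule_def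
proof (intro conjI allI impI)
  show "left_semimodule R V" using n by (rule left_semimodule_corner)
next
  obtain w where w: "w \<in> carrier V" "w \<noteq> \<zero>\<^bsub>N\<^esub>" using corner_module_nonzero[OF n] by blast
  then obtain c where "c \<in> carrier R" "w = E 0 0 c \<odot>\<^bsub>N\<^esub> w"
    using corner_module_generated[OF w n w(1)] by blast
  then show "\<exists>r\<in>carrier R. \<exists>w\<in>carrier V. r \<odot>\<^bsub>V\<^esub> w \<noteq> \<zero>\<^bsub>V\<^esub>"
    using w by (intro bexI[of _ c] bexI[of _ w]) auto
next
  fix W assume W: "subsemimodule R V W"
  show "W = {\<zero>\<^bsub>V\<^esub>} \<or> W = carrier V"
  proof (cases "W = {\<zero>\<^bsub>V\<^esub>}")
    case False
    then obtain w where w: "w \<in> W" "w \<noteq> \<zero>\<^bsub>N\<^esub>" "w \<in> carrier V"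
      using W by (auto simp: subsemimodule_def)
    have "u \<in> W" if u: "u \<in> carrier V" for u
    proof -
      obtain c where "c \<in> carrier R" "u = E 0 0 c \<odot>\<^bsub>N\<^esub> w"
        using corner_module_generated[OF w(3,2) n u] by blast
      then show ?thesis using W w(1) by (auto simp: subsemimodule_def)
    qed
    then have "W = carrier V" using W unfolding subsemimodule_def by blast
    then show ?thesis ..
  qed simp
next
  fix \<rho> assume \<rho>: "semimodule_congruence R V \<rho>"
  note \<rho>D = semimodule_congruenceD[OF \<rho>]
  interpret V: left_semimodule R V using n by (rule left_semimodule_corner)
  have zero: "(\<zero>\<^bsub>N\<^esub>, \<zero>\<^bsub>N\<^esub>) \<in> \<rho>" using \<rho>D(3)[of "\<zero>\<^bsub>V\<^esub>"] V.M.zero_closed by simp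
  let ?\<sigma> = "{(z, w). z \<in> carrier N \<and> w \<in> carrier N \<and>
    (\<forall>k<n. \<forall>a\<in>carrier R. (E 0 k a \<odot>\<^bsub>N\<^esub> z, E 0 k a \<odot>\<^bsub>N\<^esub> w) \<in> \<rho>)}"
  have "semimodule_congruence M N ?\<sigma>"
  proof (rule semimodule_congruenceI)
    fix x y z assume "(x, y) \<in> ?\<sigma>" "(y, z) \<in> ?\<sigma>"
    then show "(x, z) \<in> ?\<sigma>" using \<rho>D(5) by blast
  next
    fix x x' y y' assume *: "(x, x') \<in> ?\<sigma>" "(y, y') \<in> ?\<sigma>"
    have "(E 0 k a \<odot>\<^bsub>N\<^esub> (x \<oplus>\<^bsub>N\<^esub> y), E 0 k a \<odot>\<^bsub>N\<^esub> (x' \<oplus>\<^bsub>N\<^esub> y')) \<in> \<rho>"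
      if "k < n" "a \<in> carrier R" for k a
      using * that \<rho>D(6)[of "E 0 k a \<odot>\<^bsub>N\<^esub> x" "E 0 k a \<odot>\<^bsub>N\<^esub> x'" "E 0 k a \<odot>\<^bsub>N\<^esub> y" "E 0 k a \<odot>\<^bsub>N\<^esub> y'"]
      by (simp add: N.smult_r_distr)
    then show "(x \<oplus>\<^bsub>N\<^esub> y, x' \<oplus>\<^bsub>N\<^esub> y') \<in> ?\<sigma>" using * by simp
  next
    fix B z w assume B: "B \<in> carrier M" and zw: "(z, w) \<in> ?\<sigma>"
    have c: "z \<in> carrier N" "w \<in> carrier N" using zw by auto
    have "(E 0 k a \<odot>\<^bsub>N\<^esub> (B \<odot>\<^bsub>N\<^esub> z), E 0 k a \<odot>\<^bsub>N\<^esub> (B \<odot>\<^bsub>N\<^esub> w)) \<in> \<rho>"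
      if ka: "k < n" "a \<in> carrier R" for k a
    proof (rule matrix_relation_induct[where B = B and
          rel = "\<lambda>X Y. (E 0 k a \<odot>\<^bsub>N\<^esub> (X \<odot>\<^bsub>N\<^esub> z), E 0 k a \<odot>\<^bsub>N\<^esub> (Y \<odot>\<^bsub>N\<^esub> w)) \<in> \<rho>"])
      show "(E 0 k a \<odot>\<^bsub>N\<^esub> (\<zero>\<^bsub>M\<^esub> \<odot>\<^bsub>N\<^esub> z), E 0 k a \<odot>\<^bsub>N\<^esub> (\<zero>\<^bsub>M\<^esub> \<odot>\<^bsub>N\<^esub> w)) \<in> \<rho>"
        using ka c zero by (simp add: N.smult_l_null N.smult_r_null)
    next
      fix X Y X' Y'
      assume X: "X \<in> carrier M" "Y \<in> carrier M" "X' \<in> carrier M" "Y' \<in> carrier M"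
        and "(E 0 k a \<odot>\<^bsub>N\<^esub> (X \<odot>\<^bsub>N\<^esub> z), E 0 k a \<odot>\<^bsub>N\<^esub> (Y \<odot>\<^bsub>N\<^esub> w)) \<in> \<rho>"
          "(E 0 k a \<odot>\<^bsub>N\<^esub> (X' \<odot>\<^bsub>N\<^esub> z), E 0 k a \<odot>\<^bsub>N\<^esub> (Y' \<odot>\<^bsub>N\<^esub> w)) \<in> \<rho>"
      from \<rho>D(6)[OF this(5,6)] show "(E 0 k a \<odot>\<^bsub>N\<^esub> ((X \<oplus>\<^bsub>M\<^esub> X') \<odot>\<^bsub>N\<^esub> z),
          E 0 k a \<odot>\<^bsub>N\<^esub> ((Y \<oplus>\<^bsub>M\<^esub> Y') \<odot>\<^bsub>N\<^esub> w)) \<in> \<rho>"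
        using X ka c by (simp add: N.smult_l_distr N.smult_r_distr N.smult_closed)
    next
      fix i j assume ij: "i < n" "j < n"
      have "(E 0 j (a \<otimes> B (i, j)) \<odot>\<^bsub>N\<^esub> z, E 0 j (a \<otimes> B (i, j)) \<odot>\<^bsub>N\<^esub> w) \<in> \<rho>"
        using zw ij ka B m_closed by auto
      then show "(E 0 k a \<odot>\<^bsub>N\<^esub> (E i j (B (i, j)) \<odot>\<^bsub>N\<^esub> z), E 0 k a \<odot>\<^bsub>N\<^esub> (E i j (B (i, j)) \<odot>\<^bsub>N\<^esub> w)) \<in> \<rho>"
        using ij ka c B zero by (simp add: E_smult_E_smult)
    qed (use B in simp_all)
    then show "(B \<odot>\<^bsub>N\<^esub> z, B \<odot>\<^bsub>N\<^esub> w) \<in> ?\<sigma>" using B c by (simp add: N.smult_closed)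
  qed (use \<rho>D(3,4) corner_memI in auto)
  then consider "?\<sigma> = Id_on (carrier N)" | "?\<sigma> = carrier N \<times> carrier N"
    by (rule N.simple_congruence)
  then show "\<rho> = Id_on (carrier V) \<or> \<rho> = carrier V \<times> carrier V"
  proof cases
    case 1
    have diagonal: "z = w" if zw: "(z, w) \<in> \<rho>" for z w
    proof -
      have c: "z \<in> carrier V" "w \<in> carrier V" using \<rho>D(1)[OF zw] \<rho>D(2)[OF zw] .
      have "(E 0 k a \<odot>\<^bsub>N\<^esub> z, E 0 k a \<odot>\<^bsub>N\<^esub> w) \<in> \<rho>" if ka: "k < n" "a \<in> carrier R" for k a
      proof (cases "k = 0")
        case True
        then show ?thesis using \<rho>D(7)[OF ka(2) zw] by simp
      next
        case False
        have "E 0 k a \<odot>\<^bsub>N\<^esub> u = \<zero>\<^bsub>N\<^esub>" if "u \<in> carrier V" for u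
          using that False ka by (auto simp: corner_module_carrier E_smult_E_smult)
        then show ?thesis using c zero by simp
      qed
      then have "(z, w) \<in> ?\<sigma>" using c corner_sub by simp
      then show ?thesis unfolding 1 by (simp add: Id_on_iff)
    qed
    have "\<rho> \<subseteq> Id_on (carrier V)"
    proof (rule subrelI)
      fix z w assume zw: "(z, w) \<in> \<rho>"
      show "(z, w) \<in> Id_on (carrier V)" using diagonal[OF zw] \<rho>D(1)[OF zw] by (simp add: Id_on_iff)
    qed
    moreover have "Id_on (carrier V) \<subseteq> \<rho>" using \<rho>D(3) by auto
    ultimately show ?thesis by simp
  next
    case 2
    have collapse: "(u, \<zero>\<^bsub>N\<^esub>) \<in> \<rho>" if u: "u \<in> carrier V" for u
    proof -
      obtain j b x where x: "j < n" "b \<in> carrier R" "x \<in> carrier N" "u = E 0 j b \<odot>\<^bsub>N\<^esub> x"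
        using u by (auto simp: corner_module_carrier)
      have "(x, \<zero>\<^bsub>N\<^esub>) \<in> ?\<sigma>" unfolding 2 using x by simp
      then have "(E 0 j b \<odot>\<^bsub>N\<^esub> x, E 0 j b \<odot>\<^bsub>N\<^esub> \<zero>\<^bsub>N\<^esub>) \<in> \<rho>" using x by blast
      then show ?thesis using x by (simp add: N.smult_r_null)
    qed
    have "(u, v) \<in> \<rho>" if "u \<in> carrier V" "v \<in> carrier V" for u v
      using \<rho>D(5)[OF collapse \<rho>D(4)[OF collapse]] that .
    then have "carrier V \<times> carrier V \<subseteq> \<rho>" by auto
    moreover have "\<rho> \<subseteq> carrier V \<times> carrier V" using \<rho>D(1,2) by auto
    ultimately show ?thesis by simp
  qed
qed

end

lemma (in matrices_over) matric_J_s: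
  assumes "1 \<le> n"
  shows "R \<in> J_s_class \<longleftrightarrow> M \<in> J_s_class"
proof -
  interpret M: plain_hemiring M by (intro plain_hemiring.intro hemiring_matrix)
  have n: "0 < n" using assms by simp
  show ?thesis
  proof
    assume R: "R \<in> J_s_class"
    have False if N: "simple_semimodule M N" for N :: "(nat \<times> nat \<Rightarrow> 'a, (nat \<times> nat \<Rightarrow> 'a) set) module"
    proof -
      interpret matrix_semimodule R n N
        using N matrices_over_axioms
        by (intro matrix_semimodule.intro simple_left_semimodule.intro simple_left_semimodule_axioms.intro)
          (simp_all add: simple_semimodule_def)
      show False using J_s_class_no_simple_semimodule[OF R simple_corner_module[OF n]] .
    qed
    then show "M \<in> J_s_class" unfolding M.J_s_class_iff by blast
  next
    assume M: "M \<in> J_s_class"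
    have False if V: "simple_semimodule R V" for V :: "('a, 'a set) module"
    proof -
      interpret columns_over R n V
        using V matrices_over_axioms
        by (intro columns_over.intro simple_left_semimodule.intro simple_left_semimodule_axioms.intro)
          (simp_all add: simple_semimodule_def)
      show False using M.J_s_class_no_simple_semimodule[OF M simple_column_module[OF n]] .
    qed
    then show "R \<in> J_s_class" unfolding J_s_class_iff by blast
  qed
qed

section \<open>The three radical classes\<close>

theorem theorem5p14:
  shows "matric_extensible (jacobson_class :: 'a ring set) jacobson_class \<and>
         matric_extensible (brown_mccoy_class :: 'a ring set) brown_mccoy_class \<and>
         matric_extensible (J_s_class :: 'a ring set) J_s_class"
proof -
  have over: "matrices_over R" if "hemiring R" for R :: "'a ring"
    using that by (intro matrices_over.intro plain_hemiring.intro)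
  show ?thesis
    unfolding matric_extensible_def
    using matrices_over.matric_jacobson[OF over] matrices_over.matric_brown_mccoy[OF over]
      matrices_over.matric_J_s[OF over] by blast
qed

end
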